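(* Let $n=\dim\mathsf M>2$ and let $L$ be a (real analytic) $\mathrm{gl}$-regular $(1,1)$-tensor field on $\mathsf M$ with characteristic polynomial $\det(\lambda\,\mathrm{Id}-L)=\lambda^n-f_1\lambda^{n-1}-\dots-f_n$. 1. If $\langle L^i,L^j\rangle=0$ for all $1\le i<j\le n-1$, then $L$ is a Nijenhuis operator. 2. If $\langle M_i,M_j\rangle=0$ for all $1\le i<j\le n-1$, where $M_1=L-f_1\,\mathrm{Id}$ and $M_k=LM_{k-1}-f_k\,\mathrm{Id}$ for $2\le k\le n$, then $L$ is a Nijenhuis operator.
   Context: For commuting $(1,1)$-tensor fields $A,B$, set $\langle A,B\rangle(\xi,\xi)=[A\xi,B\xi]-B[A\xi,\xi]-A[\xi,B\xi]$ (a vector-valued quadratic form in the vector field $\xi$); $\langle A,B\rangle=0$ means that this vanishes for every vector field $\xi$. The Nijenhuis torsion of $L$ is $\mathcal N_L(\xi,\eta)=L^2[\xi,\eta]-L[L\xi,\eta]-L[\xi,L\eta]+[L\xi,L\eta]$; $L$ is Nijenhuis if $\mathcal N_L\equiv0$. $L$ is $\mathrm{gl}$-regular if $\mathrm{Id},L,\dots,L^{n-1}$ are linearly independent at every point. All objects are real analytic. *)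

theory Defs
  imports "HOL-Analysis.Analysis"
begin

section \<open>Real analytic manifolds\<close>

text \<open>Real analyticity in several variables: around each point of \<open>S\<close>, the function is the sum of an
  (absolutely) convergent power series, indexed by the multi-indices \<open>'n \<Rightarrow> nat\<close>.\<close>

definition real_analytic_on :: "(real^'n \<Rightarrow> real) \<Rightarrow> (real^'n) set \<Rightarrow> bool" where
  "real_analytic_on f S \<longleftrightarrow>
     (\<forall>p\<in>S. \<exists>r>0. \<exists>a :: ('n \<Rightarrow> nat) \<Rightarrow> real. \<forall>x\<in>ball p r.
        ((\<lambda>\<alpha>. a \<alpha> * (\<Prod>i\<in>UNIV. (x $ i - p $ i) ^ \<alpha> i)) has_sum f x) UNIV)"

text \<open>A chart is a domain together with a coordinate map, whose values outside the domain are
  irrelevant.\<close>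

type_synonym ('m, 'n) chart = "'m set \<times> ('m \<Rightarrow> real^'n)"

abbreviation chart_dom :: "('m, 'n) chart \<Rightarrow> 'm set" where
  "chart_dom c \<equiv> fst c"

abbreviation chart_map :: "('m, 'n) chart \<Rightarrow> 'm \<Rightarrow> real^'n" where
  "chart_map c \<equiv> snd c"

definition chart_inv :: "('m, 'n) chart \<Rightarrow> real^'n \<Rightarrow> 'm" where
  "chart_inv c = inv_into (chart_dom c) (chart_map c)"

definition transition :: "('m, 'n) chart \<Rightarrow> ('m, 'n) chart \<Rightarrow> real^'n \<Rightarrow> real^'n" where
  "transition c d = chart_map d \<circ> chart_inv c"

text \<open>The manifold is the whole type \<open>'m\<close>; its dimension is \<open>CARD('n)\<close>.\<close>

definition analytic_atlas ::
  "('m :: {t2_space, second_countable_topology}, 'n :: finite) chart set \<Rightarrow> bool" where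
  "analytic_atlas \<A> \<longleftrightarrow>
     (\<Union>c\<in>\<A>. chart_dom c) = UNIV \<and>
     (\<forall>c\<in>\<A>. open (chart_dom c) \<and> open (chart_map c ` chart_dom c) \<and>
        homeomorphism (chart_dom c) (chart_map c ` chart_dom c) (chart_map c) (chart_inv c)) \<and>
     (\<forall>c\<in>\<A>. \<forall>d\<in>\<A>. \<forall>i.
        real_analytic_on (\<lambda>x. transition c d x $ i) (chart_map c ` (chart_dom c \<inter> chart_dom d)))"

section \<open>Vector fields and (1,1)-tensor fields\<close>

text \<open>A field is given by its components in every chart. The value for a chart \<open>c\<close> at a point \<open>p\<close> is
  meaningful only if \<open>c\<close> belongs to the atlas and \<open>p\<close> to its domain (and to the domain of the field).
  Components in different charts are related by the transformation law of the tensor type.\<close>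

type_synonym ('m, 'n) vfield = "('m, 'n) chart \<Rightarrow> 'm \<Rightarrow> real^'n"
type_synonym ('m, 'n) tfield = "('m, 'n) chart \<Rightarrow> 'm \<Rightarrow> real^'n^'n"

definition chart_jacobian :: "('m, 'n) chart \<Rightarrow> ('m, 'n) chart \<Rightarrow> 'm \<Rightarrow> real^'n^'n" where
  "chart_jacobian c d p = jacobian (transition c d) (at (chart_map c p))"

definition analytic_vector_field ::
  "('m, 'n) chart set \<Rightarrow> 'm set \<Rightarrow> ('m, 'n :: finite) vfield \<Rightarrow> bool" where
  "analytic_vector_field \<A> W \<xi> \<longleftrightarrow>
     (\<forall>c\<in>\<A>. \<forall>i. real_analytic_on (\<lambda>x. \<xi> c (chart_inv c x) $ i) (chart_map c ` (chart_dom c \<inter> W))) \<and>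
     (\<forall>c\<in>\<A>. \<forall>d\<in>\<A>. \<forall>p \<in> chart_dom c \<inter> chart_dom d \<inter> W.
        \<xi> d p = chart_jacobian c d p *v \<xi> c p)"

definition analytic_tensor_field ::
  "('m, 'n) chart set \<Rightarrow> ('m, 'n :: finite) tfield \<Rightarrow> bool" where
  "analytic_tensor_field \<A> L \<longleftrightarrow>
     (\<forall>c\<in>\<A>. \<forall>i j. real_analytic_on (\<lambda>x. L c (chart_inv c x) $ i $ j) (chart_map c ` chart_dom c)) \<and>
     (\<forall>c\<in>\<A>. \<forall>d\<in>\<A>. \<forall>p \<in> chart_dom c \<inter> chart_dom d.
        chart_jacobian c d p ** L c p = L d p ** chart_jacobian c d p)"

definition apply_field :: "('m, 'n) tfield \<Rightarrow> ('m, 'n) vfield \<Rightarrow> ('m, 'n :: finite) vfield" where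
  "apply_field L \<xi> = (\<lambda>c p. L c p *v \<xi> c p)"

definition lie_bracket :: "('m, 'n) vfield \<Rightarrow> ('m, 'n) vfield \<Rightarrow> ('m, 'n :: finite) vfield" where
  "lie_bracket \<xi> \<eta> = (\<lambda>c p.
     frechet_derivative (\<lambda>x. \<eta> c (chart_inv c x)) (at (chart_map c p)) (\<xi> c p)
     - frechet_derivative (\<lambda>x. \<xi> c (chart_inv c x)) (at (chart_map c p)) (\<eta> c p))"

section \<open>The quadratic form of two operators and the Nijenhuis torsion\<close>

definition bracket_form ::
  "('m, 'n) tfield \<Rightarrow> ('m, 'n) tfield \<Rightarrow> ('m, 'n) vfield \<Rightarrow> ('m, 'n :: finite) vfield" where
  "bracket_form A B \<xi> = (\<lambda>c p.
     lie_bracket (apply_field A \<xi>) (apply_field B \<xi>) c p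
     - B c p *v lie_bracket (apply_field A \<xi>) \<xi> c p
     - A c p *v lie_bracket \<xi> (apply_field B \<xi>) c p)"

definition nijenhuis_torsion ::
  "('m, 'n) tfield \<Rightarrow> ('m, 'n) vfield \<Rightarrow> ('m, 'n) vfield \<Rightarrow> ('m, 'n :: finite) vfield" where
  "nijenhuis_torsion L \<xi> \<eta> = (\<lambda>c p.
     L c p *v (L c p *v lie_bracket \<xi> \<eta> c p)
     - L c p *v lie_bracket (apply_field L \<xi>) \<eta> c p
     - L c p *v lie_bracket \<xi> (apply_field L \<eta>) c p
     + lie_bracket (apply_field L \<xi>) (apply_field L \<eta>) c p)"

text \<open>As usual for analytic objects, ``every vector field'' ranges over the vector fields defined on
  arbitrary open subsets, so that both conditions are local. The first one is used for commuting
  \<open>A\<close> and \<open>B\<close>, where the form is tensorial in \<open>\<xi>\<close>.\<close>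

definition bracket_form_vanishes ::
  "('m :: topological_space, 'n :: finite) chart set \<Rightarrow> ('m, 'n) tfield \<Rightarrow> ('m, 'n) tfield \<Rightarrow> bool" where
  "bracket_form_vanishes \<A> A B \<longleftrightarrow>
     (\<forall>W \<xi>. open W \<longrightarrow> analytic_vector_field \<A> W \<xi> \<longrightarrow>
        (\<forall>c\<in>\<A>. \<forall>p \<in> chart_dom c \<inter> W. bracket_form A B \<xi> c p = 0))"

definition nijenhuis_operator ::
  "('m :: topological_space, 'n :: finite) chart set \<Rightarrow> ('m, 'n) tfield \<Rightarrow> bool" where
  "nijenhuis_operator \<A> L \<longleftrightarrow>
     (\<forall>W \<xi> \<eta>. open W \<longrightarrow> analytic_vector_field \<A> W \<xi> \<longrightarrow> analytic_vector_field \<A> W \<eta> \<longrightarrow>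
        (\<forall>c\<in>\<A>. \<forall>p \<in> chart_dom c \<inter> W. nijenhuis_torsion L \<xi> \<eta> c p = 0))"

section \<open>Powers, regularity, and the operators built from the characteristic polynomial\<close>

text \<open>The overloaded power on \<open>real^'n^'n\<close> is not available for the matrix product.\<close>

primrec tensor_power :: "('m, 'n) tfield \<Rightarrow> nat \<Rightarrow> ('m, 'n :: finite) tfield" where
  "tensor_power L 0 = (\<lambda>c p. mat 1)"
| "tensor_power L (Suc k) = (\<lambda>c p. L c p ** tensor_power L k c p)"

definition gl_regular :: "('m, 'n :: finite) chart set \<Rightarrow> ('m, 'n) tfield \<Rightarrow> bool" where
  "gl_regular \<A> L \<longleftrightarrow>
     (\<forall>c\<in>\<A>. \<forall>p \<in> chart_dom c. \<forall>a :: nat \<Rightarrow> real.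
        (\<Sum>k<CARD('n). a k *\<^sub>R tensor_power L k c p) = 0 \<longrightarrow> (\<forall>k<CARD('n). a k = 0))"

definition has_char_poly ::
  "('m, 'n :: finite) chart set \<Rightarrow> ('m, 'n) tfield \<Rightarrow> (nat \<Rightarrow> 'm \<Rightarrow> real) \<Rightarrow> bool" where
  "has_char_poly \<A> L f \<longleftrightarrow>
     (\<forall>c\<in>\<A>. \<forall>p \<in> chart_dom c. \<forall>t :: real.
        det (t *\<^sub>R mat 1 - L c p) = t ^ CARD('n) - (\<Sum>k=1..CARD('n). f k p * t ^ (CARD('n) - k)))"

text \<open>Started at the identity, so that the first operator is \<open>L - f\<^sub>1 Id\<close>.\<close>

primrec char_operator ::
  "('m, 'n) tfield \<Rightarrow> (nat \<Rightarrow> 'm \<Rightarrow> real) \<Rightarrow> nat \<Rightarrow> ('m, 'n :: finite) tfield" where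
  "char_operator L f 0 = (\<lambda>c p. mat 1)"
| "char_operator L f (Suc k) =
     (\<lambda>c p. L c p ** char_operator L f k c p - f (Suc k) p *\<^sub>R mat 1)"

end

theory Submission
  imports Defs
    "HOL-Computational_Algebra.Polynomial_Factorial"
    "HOL-Computational_Algebra.Field_as_Ring"
begin

text \<open>Only the condition for \<open>i = 1\<close>, \<open>j = 2\<close> is needed. Write \<open>N\<close> for the torsion of \<open>L\<close>. In the first
  case \<open>\<langle>L, L\<^sup>2\<rangle>(\<xi>, \<xi>) = N(\<xi>, L \<xi>)\<close>. An alternating form with \<open>N(\<xi>, L \<xi>) = 0\<close> satisfies
  \<open>N(L \<xi>, \<eta>) = N(\<xi>, L \<eta>)\<close>, hence vanishes on the powers of \<open>L\<close> applied to a cyclic vector, and such a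
  vector exists because \<open>L\<close> is gl-regular. In the second case
  \<open>\<langle>M\<^sub>1, M\<^sub>2\<rangle>(\<xi>, \<xi>) = N(\<xi>, L \<xi>) - \<theta>(L \<xi>) \<xi> + \<theta>(\<xi>) L \<xi>\<close> with
  \<open>\<theta> = df\<^sub>2 + f\<^sub>1 df\<^sub>1 - L\<^sup>* df\<^sub>1\<close>, so the same argument gives \<open>N(\<xi>, \<eta>) = \<theta>(\<eta>) \<xi> - \<theta>(\<xi>) \<eta>\<close>.
  The trace of the right-hand side in \<open>\<eta>\<close> is \<open>(1 - n) \<theta>(\<xi>)\<close>, while the trace of \<open>N(\<xi>, \<cdot>)\<close> is \<open>- \<theta>(\<xi>)\<close> since
  \<open>f\<^sub>1 = tr L\<close> and \<open>f\<^sub>1\<^sup>2 + 2 f\<^sub>2 = tr L\<^sup>2\<close>; therefore \<open>\<theta> = 0\<close> for \<open>n > 2\<close>. To evaluate the conditions at a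
  point one needs vector fields that are constant in a given chart, and these are analytic in every
  other chart because analytic functions are closed under partial derivatives and composition.\<close>

section \<open>Cyclic vectors\<close>

primrec matrix_power :: "real^'n::finite^'n \<Rightarrow> nat \<Rightarrow> real^'n^'n" where
  "matrix_power A 0 = mat 1"
| "matrix_power A (Suc k) = A ** matrix_power A k"

lemma matrix_vector_mult_sum: "(\<Sum>k\<in>I. M k) *v v = (\<Sum>k\<in>I. M k *v v)"
  for M :: "'i \<Rightarrow> real^'n::finite^'n"
  by (induction I rule: infinite_finite_induct) (simp_all add: matrix_vector_mult_add_rdistrib)

definition poly_act :: "real^'n::finite^'n \<Rightarrow> real poly \<Rightarrow> real^'n \<Rightarrow> real^'n" where
  "poly_act A p v = (\<Sum>k\<le>degree p. coeff p k *\<^sub>R (matrix_power A k *v v))"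

text \<open>The bound \<open>degree p\<close> varies with the polynomial. A common bound N is what
  makes sums of polynomials comparable, and it matches relations among the first n powers of
  A.\<close>

lemma poly_act_eq:
  assumes "degree p \<le> N"
  shows "poly_act A p v = (\<Sum>k\<le>N. coeff p k *\<^sub>R (matrix_power A k *v v))"
  unfolding poly_act_def using assms
  by (intro sum.mono_neutral_left) (auto simp: coeff_eq_0)

lemma poly_act_pCons: "poly_act A (pCons a p) v = a *\<^sub>R v + A *v poly_act A p v"
proof -
  have "poly_act A (pCons a p) v
      = (\<Sum>k\<le>Suc (degree p). coeff (pCons a p) k *\<^sub>R (matrix_power A k *v v))"
    by (rule poly_act_eq) (simp add: degree_pCons_le)
  also have "\<dots> = a *\<^sub>R v + A *v poly_act A p v"
    unfolding poly_act_def sum.atMost_Suc_shift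
    by (simp add: linear_sum[OF matrix_vector_mul_linear] matrix_vector_mult_scaleR
        matrix_vector_mul_assoc[symmetric])
  finally show ?thesis .
qed

lemma poly_act_0 [simp]: "poly_act A 0 v = 0"
  by (simp add: poly_act_def)

lemma poly_act_add: "poly_act A (p + q) v = poly_act A p v + poly_act A q v"
proof -
  define N where "N = max (degree p) (degree q)"
  have "degree (p + q) \<le> N" "degree p \<le> N" "degree q \<le> N"
    using degree_add_le_max[of p q] by (auto simp: N_def)
  then show ?thesis by (simp add: poly_act_eq scaleR_add_left sum.distrib)
qed

lemma poly_act_smult: "poly_act A (smult a p) v = a *\<^sub>R poly_act A p v"
proof -
  have "poly_act A (smult a p) v = (\<Sum>k\<le>degree p. coeff (smult a p) k *\<^sub>R (matrix_power A k *v v))"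
    by (rule poly_act_eq) (rule degree_smult_le)
  then show ?thesis by (simp add: poly_act_def scaleR_sum_right)
qed

lemma linear_poly_act: "linear (poly_act A p)"
  unfolding poly_act_def
  by (intro linear_compose_sum ballI linear_compose_scale_right matrix_vector_mul_linear)

lemma poly_act_mult: "poly_act A (p * q) v = poly_act A p (poly_act A q v)"
  by (induction p)
     (simp_all add: mult_pCons_left poly_act_add poly_act_smult poly_act_pCons)

section \<open>Linear relations among indexed families\<close>

text \<open>Translates the coefficientwise independence used in \<open>gl_regular\<close> into the
  set-based \<open>independent\<close>. Injectivity has to come along, since a repeated vector is a
  relation with coefficients 1 and -1.\<close>

lemma independent_family:
  fixes w :: "nat \<Rightarrow> 'a::real_vector"
  assumes "\<And>a. (\<Sum>k<m. a k *\<^sub>R w k) = 0 \<Longrightarrow> \<forall>k<m. a k = 0"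
  shows "inj_on w {..<m}" "independent (w ` {..<m})"
proof -
  show inj: "inj_on w {..<m}"
  proof (rule inj_onI, rule ccontr)
    fix i j assume ij: "i \<in> {..<m}" "j \<in> {..<m}" "w i = w j" "i \<noteq> j"
    define a :: "nat \<Rightarrow> real" where "a k = (if k = i then 1 else 0) - (if k = j then 1 else 0)" for k
    have "(\<Sum>k<m. a k *\<^sub>R w k) = (\<Sum>k<m. if k = i then w k else 0) - (\<Sum>k<m. if k = j then w k else 0)"
      unfolding sum_subtractf[symmetric] by (rule sum.cong) (auto simp: a_def)
    also have "\<dots> = 0" using ij by simp
    finally have "a i = 0" using assms ij(1) by blast
    then show False using ij(4) by (simp add: a_def)
  qed
  show "independent (w ` {..<m})"
  proof
    assume "dependent (w ` {..<m})"
    then obtain u where u: "\<exists>v\<in>w ` {..<m}. u v \<noteq> 0" "(\<Sum>v\<in>w ` {..<m}. u v *\<^sub>R v) = 0"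
      by (subst (asm) dependent_finite) auto
    from u(2) have "(\<Sum>k<m. u (w k) *\<^sub>R w k) = 0" by (simp add: sum.reindex[OF inj])
    with assms[of "\<lambda>k. u (w k)"] u(1) show False by blast
  qed
qed

lemma span_family:
  fixes w :: "nat \<Rightarrow> 'a::euclidean_space"
  assumes "\<And>a. (\<Sum>k<DIM('a). a k *\<^sub>R w k) = 0 \<Longrightarrow> \<forall>k<DIM('a). a k = 0"
  shows "span (w ` {..<DIM('a)}) = UNIV"
proof -
  note ind = independent_family[where w = w, OF assms]
  have "card (w ` {..<DIM('a)}) = DIM('a)" using ind(1) by (simp add: card_image)
  then show ?thesis using card_ge_dim_independent[OF subset_UNIV ind(2)] by auto
qed

lemma family_relation:
  fixes w :: "nat \<Rightarrow> 'a::euclidean_space"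
  obtains a where "(\<Sum>k\<le>DIM('a). a k *\<^sub>R w k) = 0" "\<exists>k\<le>DIM('a). a k \<noteq> 0"
proof (rule ccontr)
  assume "\<not> thesis"
  with that have *: "(\<Sum>k<Suc DIM('a). a k *\<^sub>R w k) = 0 \<Longrightarrow> \<forall>k<Suc DIM('a). a k = 0" for a
    unfolding lessThan_Suc_atMost less_Suc_eq_le by blast
  note ind = independent_family[where w = w, OF *]
  have "card (w ` {..<Suc DIM('a)}) = Suc DIM('a)" using ind(1) by (simp only: card_image card_lessThan)
  then show False using independent_bound[OF ind(2)] by simp
qed

section \<open>Annihilating polynomials and existence of a cyclic vector\<close>

lemma finite_submultisets: "finite {M. M \<subseteq># N}"
proof (induction N)
  case (add x N)
  have "{M. M \<subseteq># add_mset x N} \<subseteq> {M. M \<subseteq># N} \<union> add_mset x ` {M. M \<subseteq># N}"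
  proof
    fix M assume M: "M \<in> {M. M \<subseteq># add_mset x N}"
    show "M \<in> {M. M \<subseteq># N} \<union> add_mset x ` {M. M \<subseteq># N}"
    proof (cases "x \<in># M")
      case True
      then obtain M' where "M = add_mset x M'" by (auto dest: multi_member_split)
      with M show ?thesis by simp
    next
      case False
      with M show ?thesis using subset_eq_diff_conv[of M "{#x#}" N]
        by (simp add: diff_single_trivial)
    qed
  qed
  then show ?case using add finite_subset by blast
qed simp

text \<open>A normalized divisor is determined by its prime factorization, and that is a submultiset
  of the factorization of x.\<close>

lemma finite_normalized_divisors:
  fixes x :: "'a :: factorial_semiring_multiplicative"
  assumes "x \<noteq> 0"
  shows "finite {y. y dvd x \<and> normalize y = y}"
proof (rule finite_imageD)
  show "finite (prime_factorization ` {y. y dvd x \<and> normalize y = y})"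
    by (rule finite_subset[OF _ finite_submultisets[of "prime_factorization x"]])
       (use assms in \<open>force simp: prime_factorization_subset_iff_dvd\<close>)
  show "inj_on prime_factorization {y. y dvd x \<and> normalize y = y}"
    using assms by (intro inj_onI) (metis (mono_tags) mem_Collect_eq prime_factorization_unique dvd_0_left)
qed

text \<open>The matrices form a space of finite dimension N, so the N + 1 powers of A with exponents
  0 to N satisfy a nontrivial relation. Any nonzero annihilating polynomial will do, minimality
  plays no part.\<close>

lemma ex_annihilating_poly:
  fixes A :: "real^'n::finite^'n"
  obtains m where "m \<noteq> 0" "\<And>v. poly_act A m v = 0"
proof -
  obtain a where a: "(\<Sum>k\<le>DIM(real^'n^'n). a k *\<^sub>R matrix_power A k) = 0"
     "\<exists>k\<le>DIM(real^'n^'n). a k \<noteq> 0" by (rule family_relation)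
  define N where "N = DIM(real^'n^'n)"
  define m where "m = (\<Sum>k\<le>N. monom (a k) k)"
  have c: "coeff m k = (if k \<le> N then a k else 0)" for k
    by (simp add: m_def coeff_sum)
  have deg: "degree m \<le> N" by (rule degree_le) (simp add: c)
  have "poly_act A m v = (\<Sum>k\<le>N. a k *\<^sub>R matrix_power A k) *v v" for v
    by (simp add: poly_act_eq[OF deg] c matrix_vector_mult_sum scaleR_matrix_vector_assoc)
  then have "poly_act A m v = 0" for v using a(1) by (simp add: N_def)
  moreover have "m \<noteq> 0" using a(2) c by (metis N_def coeff_0)
  ultimately show thesis using that by blast
qed

text \<open>Measure is the device for showing that finitely many proper subspaces do not cover the
  space: each has measure zero, hence so does their union.\<close>

lemma negligible_subspace:
  fixes S :: "'a::euclidean_space set"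
  assumes "subspace S" "S \<noteq> UNIV"
  shows "negligible S"
proof (rule negligible_lowdim)
  have "span S = S" using assms(1) by (simp only: span_eq_iff)
  with assms(2) have "span S \<noteq> UNIV" by (simp only: not_False_eq_True)
  then have "dim S \<noteq> DIM('a)" by (simp only: dim_eq_full not_False_eq_True)
  then show "dim S < DIM('a)" using dim_subset_UNIV[of S] by simp
qed

text \<open>If no vector is cyclic, each one is killed by a divisor of degree below \<open>n\<close> of an annihilating
  polynomial of \<open>A\<close>. There are finitely many normalized divisors, and finitely many proper subspaces do not
  cover the space.\<close>

lemma ex_cyclic_vector:
  fixes A :: "real^'n::finite^'n"
  assumes reg: "\<And>a. (\<Sum>k<CARD('n). a k *\<^sub>R matrix_power A k) = 0 \<Longrightarrow> \<forall>k<CARD('n). a k = 0"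
  obtains v where "span ((\<lambda>k. matrix_power A k *v v) ` {..<CARD('n)}) = UNIV"
proof (rule ccontr)
  assume no: "\<not> thesis"
  obtain m where m: "m \<noteq> 0" "\<And>v. poly_act A m v = 0" using ex_annihilating_poly by blast
  define D where "D = {d. (d dvd m \<and> normalize d = d) \<and> degree d < CARD('n)}"
  have fin: "finite D"
    unfolding D_def by (rule finite_subset[OF _ finite_normalized_divisors[OF m(1)]]) auto
  have "\<exists>d\<in>D. poly_act A d v = 0" for v
  proof -
    \<comment> \<open>Without a relation among these n vectors they would span, and v would be
      cyclic.\<close>
    have "\<exists>a. (\<Sum>k<CARD('n). a k *\<^sub>R (matrix_power A k *v v)) = 0 \<and> \<not> (\<forall>k<CARD('n). a k = 0)"
    proof (rule ccontr)
      assume "\<not> ?thesis"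
      then have "span ((\<lambda>k. matrix_power A k *v v) ` {..<DIM(real^'n)}) = UNIV"
        by (intro span_family) auto
      with no that show False by simp
    qed
    then obtain a where a: "(\<Sum>k<CARD('n). a k *\<^sub>R (matrix_power A k *v v)) = 0"
       "\<exists>k<CARD('n). a k \<noteq> 0" by blast
    define q where "q = (\<Sum>k<CARD('n). monom (a k) k)"
    have c: "coeff q k = (if k < CARD('n) then a k else 0)" for k
      by (simp add: q_def coeff_sum)
    obtain N where N: "CARD('n) = Suc N" by (metis gr0_conv_Suc zero_less_card_finite)
    have deg: "degree q \<le> N" by (rule degree_le) (simp add: c N)
    have "poly_act A q v = 0"
      using a(1) unfolding poly_act_eq[OF deg] N lessThan_Suc_atMost by (simp add: c N less_Suc_eq_le)
    have "q \<noteq> 0" using a(2) c by (metis coeff_0)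
    \<comment> \<open>Both q and m kill v, so by Bezout their gcd does. It is normalized, divides m,
      and has degree at most that of q, hence lies in the finite set D, which does not depend on
      v.\<close>
    obtain x y where xy: "x * q + y * m = gcd q m"
      using bezout_coefficients_fst_snd by blast
    have "poly_act A (gcd q m) v = 0"
      unfolding xy[symmetric] poly_act_add poly_act_mult \<open>poly_act A q v = 0\<close> m(2)
      by (simp add: linear_0[OF linear_poly_act])
    moreover have "degree (gcd q m) < CARD('n)"
      using dvd_imp_degree_le[OF gcd_dvd1[of q m] \<open>q \<noteq> 0\<close>] deg by (simp add: N)
    ultimately show ?thesis by (auto simp: D_def)
  qed
  then have "(\<Union>d\<in>D. {v. poly_act A d v = 0}) = UNIV" by auto
  moreover have "negligible (\<Union>d\<in>D. {v. poly_act A d v = 0})"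
  proof (rule negligible_Union[OF finite_imageI[OF fin]])
    fix T assume "T \<in> (\<lambda>d. {v. poly_act A d v = 0}) ` D"
    then obtain d where d: "d \<in> D" "T = {v. poly_act A d v = 0}" by blast
    \<comment> \<open>If d(A) were zero, its coefficients would form a relation among the first n
      powers of A. Regularity then gives d = 0, which cannot divide the nonzero m.\<close>
    have "T \<noteq> UNIV"
    proof
      assume "T = UNIV"
      then have z: "poly_act A d v = 0" for v using d(2) by blast
      obtain N where N: "CARD('n) = Suc N" by (metis gr0_conv_Suc zero_less_card_finite)
      have deg: "degree d \<le> N" using d(1) by (simp add: D_def N)
      have "(\<Sum>k<CARD('n). coeff d k *\<^sub>R matrix_power A k) *v v = 0 *v v" for v
        using z[of v] unfolding poly_act_eq[OF deg] N lessThan_Suc_atMost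
        by (simp add: matrix_vector_mult_sum scaleR_matrix_vector_assoc)
      then have "(\<Sum>k<CARD('n). coeff d k *\<^sub>R matrix_power A k) = 0" by (subst matrix_eq) simp
      then have "\<forall>k<CARD('n). coeff d k = 0" by (rule reg)
      then have "lead_coeff d = 0" using deg by (simp add: N)
      then show False using d(1) m(1) by (auto simp: D_def)
    qed
    then show "negligible T"
      unfolding d(2) by (intro negligible_subspace linear_subspace_kernel linear_poly_act)
  qed
  ultimately show False by simp
qed

text \<open>Polarizing B(x, A x) = 0 lets A move from one argument to the other. Hence
  B(\<open>A\<^sup>i v\<close>, \<open>A\<^sup>j v\<close>) depends on i + j only, is therefore
  symmetric in i and j, and being also antisymmetric it is zero. The values lie in any real vector
  space because the torsion is vector-valued.\<close>

lemma alternating_form_zero: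
  fixes B :: "real^'n::finite \<Rightarrow> real^'n \<Rightarrow> 'a::real_vector"
  assumes cyc: "span ((\<lambda>k. matrix_power A k *v v) ` {..<m}) = UNIV"
    and B: "bilinear B" and anti: "\<And>x y. B x y = - B y x" and BA: "\<And>x. B x (A *v x) = 0"
  shows "B x y = 0"
proof -
  have sym: "B x (A *v y) = B (A *v x) y" for x y
  proof -
    have "B (x + y) (A *v (x + y)) = B x (A *v x) + B x (A *v y) + (B y (A *v x) + B y (A *v y))"
      by (simp add: matrix_vector_right_distrib bilinear_ladd[OF B] bilinear_radd[OF B])
    then have "B x (A *v y) + B y (A *v x) = 0" by (simp only: BA) simp
    then show ?thesis using anti[of y "A *v x"] by simp
  qed
  define w where "w k = matrix_power A k *v v" for k
  have w: "A *v w k = w (Suc k)" for k by (simp add: w_def matrix_vector_mul_assoc)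
  have shift: "B (w i) (w j) = B (w 0) (w (i + j))" for i j
  proof (induction i arbitrary: j)
    case (Suc i)
    have "B (w (Suc i)) (w j) = B (w i) (w (Suc j))" using sym[of "w i" "w j"] by (simp add: w)
    then show ?case using Suc[of "Suc j"] by simp
  qed simp
  have "B (w i) (w j) = 0" for i j
  proof -
    have "B (w i) (w j) = - B (w i) (w j)"
      using anti[of "w i" "w j"] shift[of i j] shift[of j i] by (simp add: add.commute)
    then have "(2::real) *\<^sub>R B (w i) (w j) = 0" unfolding scaleR_2 eq_neg_iff_add_eq_0 .
    then show ?thesis by simp
  qed
  moreover have "bilinear (\<lambda>x y. 0 :: 'a)" by (simp add: bilinear_def linear_zero)
  ultimately show ?thesis
    using bilinear_eq[OF B, of "\<lambda>x y. 0" UNIV "w ` {..<m}" UNIV "w ` {..<m}" x y] cyc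
    by (auto simp: w_def[abs_def])
qed

section \<open>Coefficients of the characteristic polynomial\<close>

text \<open>Differentiate the Leibniz expansion. A permutation p other than the identity moves some
  a and also p a, so after one factor has been differentiated an off-diagonal zero of the identity
  matrix is still left in the product; only p = id contributes.\<close>

lemma has_real_derivative_det_at_identity:
  fixes A :: "real^'n::finite^'n"
  shows "((\<lambda>s. det (mat 1 + s *\<^sub>R A)) has_real_derivative trace A) (at 0)"
proof -
  let ?P = "{p :: 'n \<Rightarrow> 'n. p permutes UNIV}"
  define M where "M s = mat 1 + s *\<^sub>R A" for s :: real
  have M: "M s $ i $ j = (if i = j then 1 else 0) + s * A $ i $ j" for s i j
    by (simp add: M_def mat_def)
  define D where "D p = (\<Sum>i\<in>UNIV. A $ i $ p i * (\<Prod>j\<in>UNIV - {i}. M 0 $ j $ p j))" for p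
  have "((\<lambda>s. \<Sum>p\<in>?P. of_int (sign p) * (\<Prod>i\<in>UNIV. M s $ i $ p i)) has_real_derivative
      (\<Sum>p\<in>?P. of_int (sign p) * D p)) (at 0)"
  proof (intro DERIV_sum DERIV_cmult)
    fix p :: "'n \<Rightarrow> 'n"
    have "((\<lambda>s. M s $ i $ p i) has_derivative (\<lambda>s. s * A $ i $ p i)) (at 0)" for i
      unfolding M by (auto intro!: derivative_eq_intros)
    note d = has_derivative_prod[of UNIV "\<lambda>i s. M s $ i $ p i", OF this]
    have "(\<lambda>y. \<Sum>i\<in>UNIV. y * A $ i $ p i * (\<Prod>j\<in>UNIV - {i}. M 0 $ j $ p j)) = (*) (D p)"
      by (rule ext) (simp add: D_def sum_distrib_left mult_ac)
    with d show "((\<lambda>s. \<Prod>i\<in>UNIV. M s $ i $ p i) has_real_derivative D p) (at 0)"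
      unfolding has_field_derivative_def by (simp only:)
  qed
  also have "(\<lambda>s. \<Sum>p\<in>?P. of_int (sign p) * (\<Prod>i\<in>UNIV. M s $ i $ p i)) = (\<lambda>s. det (M s))"
    by (simp add: det_def)
  also have "(\<Sum>p\<in>?P. of_int (sign p) * D p) = (\<Sum>p\<in>{id}. of_int (sign p) * D p)"
  proof (rule sum.mono_neutral_right)
    show "\<forall>p\<in>?P - {id}. of_int (sign p) * D p = 0"
    proof
      fix p assume p: "p \<in> ?P - {id}"
      then obtain a where a: "p a \<noteq> a" by (auto simp: fun_eq_iff)
      have "p (p a) \<noteq> p a" using p a by (auto dest: permutes_inj injD)
      have "(\<Prod>j\<in>UNIV - {i}. M 0 $ j $ p j) = 0" for i
      proof (rule prod_zero)
        show "\<exists>j\<in>UNIV - {i}. M 0 $ j $ p j = 0"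
          using a \<open>p (p a) \<noteq> p a\<close> by (cases "i = a") (auto simp: M intro: bexI[of _ a] bexI[of _ "p a"])
      qed simp
      then show "of_int (sign p) * D p = 0" by (simp only: D_def mult_zero_right sum.neutral_const)
    qed
  qed (auto simp: permutes_id)
  also have "\<dots> = trace A" by (simp add: D_def M trace_def)
  finally show ?thesis by (simp add: M_def)
qed

lemma det_scaleR: "det (s *\<^sub>R A) = s ^ CARD('n) * det A" for A :: "real^'n::finite^'n"
  using det_rows_mul[of "\<lambda>_. s" "\<lambda>i. A $ i"]
  by (simp add: scalar_mult_eq_scaleR) (simp add: scaleR_vec_def vec_lambda_eta)

lemma tendsto_det_quotient:
  fixes A :: "real^'n::finite^'n"
  shows "((\<lambda>s. (1 - det (mat 1 - s *\<^sub>R A)) / s) \<longlongrightarrow> trace A) (at 0)"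
  using has_real_derivative_det_at_identity[of "- A"] tendsto_minus
  unfolding has_field_derivative_iff
  by (force simp: minus_divide_left trace_def sum_negf)

text \<open>The first two Newton identities, obtained by limits. With P(s) = det(1 - s A) = 1 - f 1
  s - f 2 s^2 - ..., the first-order term of P gives the trace of A. Since P(s) P(-s) = det(1 - s^2
  A^2), the coefficient of s^2 in that product gives the trace of A^2.\<close>

lemma char_poly_coeffs:
  fixes A :: "real^'n::finite^'n"
  assumes n: "CARD('n) \<ge> 2"
    and f: "\<And>t. det (t *\<^sub>R mat 1 - A) = t ^ CARD('n) - (\<Sum>k=1..CARD('n). f k * t ^ (CARD('n) - k))"
  shows "f 1 = trace A" "f 1 ^ 2 + 2 * f 2 = trace (A ** A)"
proof -
  define P where "P s = det (mat 1 - s *\<^sub>R A)" for s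
  define Q where "Q s = (\<Sum>k=2..CARD('n). f k * s ^ (k - 2))" for s
  \<comment> \<open>Substituting t = 1 / s and multiplying by s^n reverses the characteristic
    polynomial.\<close>
  have P: "P s = 1 - f 1 * s - s^2 * Q s" if "s \<noteq> 0" for s
  proof -
    have "P s = det (s *\<^sub>R ((1 / s) *\<^sub>R mat 1 - A))"
      using that by (simp add: P_def scaleR_diff_right)
    also have "\<dots> = s ^ CARD('n) * ((1 / s) ^ CARD('n) - (\<Sum>k=1..CARD('n). f k * (1 / s) ^ (CARD('n) - k)))"
      by (simp only: det_scaleR f)
    also have "\<dots> = 1 - (\<Sum>k=1..CARD('n). f k * s ^ k)"
    proof -
      have "s ^ CARD('n) * (f k * (1 / s) ^ (CARD('n) - k)) = f k * s ^ k" if "k \<in> {1..CARD('n)}" for k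
        using that \<open>s \<noteq> 0\<close> by (simp add: power_divide power_diff)
      then show ?thesis
        using that by (simp add: right_diff_distrib sum_distrib_left power_divide)
    qed
    also have "(\<Sum>k=1..CARD('n). f k * s ^ k) = f 1 * s + (\<Sum>k=2..CARD('n). f k * s ^ k)"
      using n by (simp add: sum.atLeast_Suc_atMost numeral_2_eq_2)
    also have "(\<Sum>k=2..CARD('n). f k * s ^ k) = s^2 * Q s"
      unfolding Q_def sum_distrib_left
    proof (rule sum.cong)
      fix k assume "k \<in> {2..CARD('n)}"
      then have "s ^ k = s^2 * s ^ (k - 2)"
        by (metis atLeastAtMost_iff le_add_diff_inverse power_add)
      then show "f k * s ^ k = s^2 * (f k * s ^ (k - 2))" by (simp only: mult.left_commute)
    qed simp
    finally show ?thesis by simp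
  qed
  \<comment> \<open>Only k = 2 survives, through 0 ^ 0 = 1.\<close>
  have Q0: "Q 0 = f 2"
  proof -
    have "Q 0 = (\<Sum>k=2..CARD('n). if k = 2 then f k else 0)"
      unfolding Q_def by (rule sum.cong) (auto simp: power_0_left)
    then show ?thesis using n by simp
  qed
  have Qlim: "(Q \<longlongrightarrow> f 2) (at 0)"
    using isCont_def[of 0 Q] Q0 unfolding Q_def by (auto intro!: continuous_intros)
  have Qlim': "((\<lambda>s. Q (- s)) \<longlongrightarrow> f 2) (at 0)"
    by (rule filterlim_compose[OF Qlim]) (auto intro!: tendsto_eq_intros simp: filterlim_at eventually_at_filter)
  have ev: "\<forall>\<^sub>F s in at 0. s \<noteq> (0::real)" by (rule eventually_neq_at_within)
  have "((\<lambda>s. f 1 + s * Q s) \<longlongrightarrow> f 1 + 0 * f 2) (at 0)"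
    by (intro tendsto_intros Qlim)
  then have "((\<lambda>s. (1 - P s) / s) \<longlongrightarrow> f 1 + 0 * f 2) (at 0)"
    by (rule Lim_transform_eventually) (use ev in \<open>eventually_elim, simp add: P field_simps power2_eq_square\<close>)
  then show "f 1 = trace A"
    using tendsto_unique[OF _ _ tendsto_det_quotient[of A]] by (simp add: P_def)
  define E where "E u = det (mat 1 - u *\<^sub>R (A ** A))" for u
  have E: "E (s^2) = P s * P (- s)" for s
  proof -
    have "(mat 1 - s *\<^sub>R A) ** (mat 1 - (- s) *\<^sub>R A) = mat 1 - s^2 *\<^sub>R (A ** A)"
      by (subst matrix_eq) (simp add: matrix_vector_mul_assoc[symmetric] matrix_vector_mult_diff_rdistrib
          matrix_vector_mult_diff_distrib matrix_vector_mult_add_rdistrib matrix_vector_right_distrib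
          matrix_vector_mult_scaleR scaleR_matrix_vector_assoc[symmetric] power2_eq_square scaleR_diff_right)
    then show ?thesis unfolding E_def P_def det_mul[symmetric] by simp
  qed
  have sq: "filterlim (\<lambda>s. s^2) (at 0) (at (0::real))"
    by (auto intro!: tendsto_eq_intros simp: filterlim_at eventually_at_filter)
  have "((\<lambda>s. (1 - E (s^2)) / s^2) \<longlongrightarrow> trace (A ** A)) (at 0)"
    unfolding E_def by (rule filterlim_compose[OF tendsto_det_quotient sq])
  \<comment> \<open>Expanding 1 - P(s) P(-s), the first-order terms cancel and s^2 can be divided
    out; what remains is f 1 ^ 2 + Q(s) + Q(-s) plus terms with a factor s.\<close>
  moreover have "((\<lambda>s. (1 - E (s^2)) / s^2) \<longlongrightarrow> f 1 ^ 2 + 2 * f 2) (at 0)"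
  proof (rule Lim_transform_eventually)
    show "((\<lambda>s. f 1 ^ 2 + (Q s + Q (- s)) + s * (f 1 * (Q s - Q (- s)) - s * (Q s * Q (- s))))
        \<longlongrightarrow> f 1 ^ 2 + 2 * f 2) (at 0)"
      by (auto intro!: tendsto_eq_intros Qlim Qlim')
    show "\<forall>\<^sub>F s in at 0. f 1 ^ 2 + (Q s + Q (- s)) + s * (f 1 * (Q s - Q (- s)) - s * (Q s * Q (- s)))
        = (1 - E (s^2)) / s^2"
      using ev
    proof eventually_elim
      case (elim s)
      have "1 - E (s^2) = s^2 * (f 1 ^ 2 + (Q s + Q (- s)) + s * (f 1 * (Q s - Q (- s)) - s * (Q s * Q (- s))))"
        using elim by (simp add: E P) algebra
      then show ?case using elim by simp
    qed
  qed
  ultimately show "f 1 ^ 2 + 2 * f 2 = trace (A ** A)"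
    by (intro tendsto_unique[of "at (0::real)"]) auto
qed

section \<open>The torsion at a point\<close>

lemma matrix_mult_scaleR: "A ** (c *\<^sub>R B) = c *\<^sub>R (A ** B)" for A :: "real^'n::finite^'m"
  by (simp add: matrix_matrix_mult_def vec_eq_iff sum_distrib_left mult_ac)

lemma trace_scaleR: "trace (c *\<^sub>R A) = c * trace A" for A :: "real^'n::finite^'n"
  by (simp add: trace_def sum_distrib_left)

text \<open>The torsion of L at a point in coordinates: A is the value of L there and D h the
  derivative of its components in direction h. The vector fields enter by their values only, see
  \<open>nijenhuis_torsion_eq\<close>.\<close>

definition torsion_at ::
  "real^'n::finite^'n \<Rightarrow> (real^'n \<Rightarrow> real^'n^'n) \<Rightarrow> real^'n \<Rightarrow> real^'n \<Rightarrow> real^'n" where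
  "torsion_at A D u v = D (A *v u) *v v - D (A *v v) *v u - A *v (D u *v v) + A *v (D v *v u)"

lemma torsion_at_swap: "torsion_at A D u v = - torsion_at A D v u"
  by (simp add: torsion_at_def)

lemma bilinear_torsion_at:
  assumes "linear D"
  shows "bilinear (torsion_at A D)"
proof -
  have "linear (torsion_at A D u)" for u
    unfolding torsion_at_def
    by (rule linearI)
       (simp_all add: linear_add[OF assms] linear_scale[OF assms] matrix_vector_right_distrib
         matrix_vector_mult_add_rdistrib matrix_vector_mult_scaleR scaleR_matrix_vector_assoc[symmetric]
         scaleR_diff_right scaleR_add_right)
  moreover from this have "linear (\<lambda>u. - torsion_at A D v u)" for v by (rule linear_compose_neg)
  then have "linear (\<lambda>u. torsion_at A D u v)" for v unfolding torsion_at_swap[of A D _ v] .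
  ultimately show ?thesis by (simp add: bilinear_def)
qed

text \<open>A trace for maps given as functions, so that the torsion with one argument fixed need
  not first be written as a matrix.\<close>

definition trace_fun :: "(real^'n::finite \<Rightarrow> real^'n) \<Rightarrow> real" where
  "trace_fun g = (\<Sum>i\<in>UNIV. g (axis i 1) $ i)"

lemma trace_fun_matrix: "trace_fun (\<lambda>v. M *v v) = trace M"
  by (simp add: trace_fun_def trace_def matrix_vector_mult_basis column_def)

lemma trace_fun_add: "trace_fun (\<lambda>v. g v + h v) = trace_fun g + trace_fun h"
  by (simp add: trace_fun_def sum.distrib)

lemma trace_fun_diff: "trace_fun (\<lambda>v. g v - h v) = trace_fun g - trace_fun h"
  by (simp add: trace_fun_def sum_subtractf)

lemma trace_fun_commute:
  assumes "linear g"
  shows "trace_fun (\<lambda>v. A *v g v) = trace_fun (\<lambda>v. g (A *v v))"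
proof -
  obtain G where g: "g = (\<lambda>v. G *v v)"
  proof
    show "g = (\<lambda>v. matrix g *v v)"
      using matrix_works[OF linear_matrix_vector_mul_eq[THEN iffD2, OF assms]] by auto
  qed
  show ?thesis
    unfolding g matrix_vector_mul_assoc trace_fun_matrix by (rule trace_mul_sym)
qed

lemma trace_fun_rank_one:
  assumes "linear \<theta>"
  shows "trace_fun (\<lambda>v. \<theta> v *\<^sub>R u) = \<theta> u"
proof -
  have "\<theta> u = \<theta> (\<Sum>i\<in>UNIV. u $ i *\<^sub>R axis i 1)"
    using basis_expansion[of u] by (simp add: scalar_mult_eq_scaleR)
  also have "\<dots> = trace_fun (\<lambda>v. \<theta> v *\<^sub>R u)"
    by (simp add: trace_fun_def linear_sum[OF assms] linear_scale[OF assms] mult.commute)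
  finally show ?thesis by simp
qed

text \<open>As maps of v, the terms D(A v) u and A(D(v) u) have the same trace by cyclicity and
  enter with opposite signs, so they cancel.\<close>

lemma trace_torsion_at:
  assumes D: "linear D"
  shows "trace_fun (torsion_at A D u) = trace (D (A *v u)) - trace (A ** D u)"
proof -
  have lin: "linear (\<lambda>v. D v *v u)"
    by (rule linearI) (simp_all add: linear_add[OF D] linear_scale[OF D]
      matrix_vector_mult_add_rdistrib scaleR_matrix_vector_assoc[symmetric])
  have "trace_fun (torsion_at A D u) = trace (D (A *v u)) - trace_fun (\<lambda>v. D (A *v v) *v u)
      - trace (A ** D u) + trace_fun (\<lambda>v. A *v (D v *v u))"
    unfolding torsion_at_def trace_fun_add trace_fun_diff matrix_vector_mul_assoc trace_fun_matrix ..
  then show ?thesis using trace_fun_commute[OF lin, of A] by simp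
qed

text \<open>The covector \<open>\<theta>\<close> enters as minus the trace of the torsion, by
  \<open>trace_torsion_at\<close>. This makes it comparable with the trace of the formula that the
  quadratic condition forces on the torsion.\<close>

lemma torsion_at_zero:
  fixes A :: "real^'n::finite^'n"
  assumes n: "CARD('n) > 2" and D: "linear D"
    and cyc: "span ((\<lambda>k. matrix_power A k *v z) ` {..<m}) = UNIV"
    and \<theta>: "\<And>u. \<theta> u = trace (A ** D u) - trace (D (A *v u))"
    and Q: "\<And>v. torsion_at A D v (A *v v) = \<theta> (A *v v) *\<^sub>R v - \<theta> v *\<^sub>R (A *v v)"
  shows "torsion_at A D u v = 0"
proof -
  have lin: "linear \<theta>"
    unfolding \<theta> by (rule linearI)
      (simp_all add: linear_add[OF D] linear_scale[OF D] matrix_vector_right_distrib matrix_add_ldistrib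
        trace_add matrix_vector_mult_scaleR matrix_mult_scaleR trace_scaleR right_diff_distrib)
  \<comment> \<open>The subtracted term is alternating and agrees with the torsion on every pair (v,
    A v), so the difference falls under \<open>alternating_form_zero\<close>.\<close>
  define B where "B u v = torsion_at A D u v - (\<theta> v *\<^sub>R u - \<theta> u *\<^sub>R v)" for u v
  have T: "linear (\<lambda>v. torsion_at A D u v)" "linear (\<lambda>u. torsion_at A D u v)" for u v
    using bilinear_torsion_at[OF D, of A] unfolding bilinear_def by blast+
  have S: "linear (\<lambda>v. \<theta> v *\<^sub>R u)" "linear (\<lambda>v. \<theta> u *\<^sub>R v)" for u
    by (rule linearI, simp_all add: linear_add[OF lin] linear_scale[OF lin] scaleR_add_left
          scaleR_add_right mult.commute)+
  have "bilinear B"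
    unfolding bilinear_def B_def by (intro conjI allI linear_compose_sub T S)
  then have "B u v = 0" for u v
  proof (rule alternating_form_zero[OF cyc])
    show "B x y = - B y x" for x y using torsion_at_swap[of A D x y] by (simp add: B_def)
    show "B x (A *v x) = 0" for x using Q[of x] by (simp add: B_def)
  qed
  then have N: "torsion_at A D u v = \<theta> v *\<^sub>R u - \<theta> u *\<^sub>R v" for u v by (simp add: B_def)
  have "\<theta> u = 0" for u
  proof -
    have "- \<theta> u = trace_fun (torsion_at A D u)" by (simp add: trace_torsion_at[OF D] \<theta>)
    also have "torsion_at A D u = (\<lambda>v. \<theta> v *\<^sub>R u - (\<theta> u *\<^sub>R mat 1) *v v)"
      by (rule ext) (simp add: N scaleR_matrix_vector_assoc[symmetric])
    also have "trace_fun \<dots> = \<theta> u - \<theta> u * CARD('n)"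
      unfolding trace_fun_diff trace_fun_rank_one[OF lin] trace_fun_matrix
      by (simp add: trace_def mat_def)
    \<comment> \<open>The two traces give - \<open>\<theta>\<close> = (1 - n)
      \<open>\<theta>\<close>, and n - 2 is nonzero.\<close>
    finally have "\<theta> u * (real CARD('n) - 2) = 0" by (simp add: algebra_simps)
    then show ?thesis using n by simp
  qed
  then show ?thesis by (simp add: N)
qed

section \<open>Calculus of real analytic functions\<close>

definition monomial_at :: "real^'n::finite \<Rightarrow> ('n \<Rightarrow> nat) \<Rightarrow> real" where
  "monomial_at y \<alpha> = (\<Prod>i\<in>UNIV. (y $ i) ^ \<alpha> i)"

text \<open>Boxes rather than balls, because on a box every monomial is bounded by its value at the
  corner displacement \<open>vec s\<close>.\<close>

definition in_box :: "real^'n \<Rightarrow> real \<Rightarrow> real^'n \<Rightarrow> bool" where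
  "in_box p s x \<longleftrightarrow> (\<forall>i. \<bar>x $ i - p $ i\<bar> \<le> s)"

text \<open>Convergence on the closed box of radius \<open>s\<close> with \<open>\<Sum>|a\<^sub>\<alpha>| s\<^sup>|\<^sup>\<alpha>\<^sup>| \<le> C\<close>: this weighted norm is submultiplicative and
  countably subadditive, so closure under composition reduces to estimates of norms.\<close>

definition majorized :: "real^'n::finite \<Rightarrow> real \<Rightarrow> (real^'n \<Rightarrow> real) \<Rightarrow> real \<Rightarrow> bool" where
  "majorized p s f C \<longleftrightarrow> (\<exists>a D. D \<le> C \<and>
     ((\<lambda>\<alpha>. \<bar>a \<alpha>\<bar> * monomial_at (vec s) \<alpha>) has_sum D) UNIV \<and>
     (\<forall>x. in_box p s x \<longrightarrow> ((\<lambda>\<alpha>. a \<alpha> * monomial_at (x - p) \<alpha>) has_sum f x) UNIV))"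

lemma monomial_at_add:
  "monomial_at y (\<lambda>i. \<alpha> i + \<beta> i) = monomial_at y \<alpha> * monomial_at y \<beta>"
  by (simp add: monomial_at_def power_add prod.distrib)

lemma monomial_at_pos: "s > 0 \<Longrightarrow> monomial_at (vec s) \<alpha> > 0"
  by (auto simp: monomial_at_def intro!: prod_pos)

lemma monomial_at_nonneg: "s > 0 \<Longrightarrow> 0 \<le> monomial_at (vec s) \<alpha>"
  by (rule less_imp_le[OF monomial_at_pos])

lemma abs_monomial_at_le:
  assumes "\<And>i. \<bar>y $ i\<bar> \<le> s"
  shows "\<bar>monomial_at y \<alpha>\<bar> \<le> monomial_at (vec s) \<alpha>"
  unfolding monomial_at_def abs_prod by (auto intro!: prod_mono simp: power_abs power_mono assms)

lemma abs_summable_on_real: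
  fixes f :: "'a \<Rightarrow> real"
  shows "(\<lambda>x. \<bar>f x\<bar>) summable_on A \<Longrightarrow> f summable_on A"
  using summable_on_iff_abs_summable_on_real[of f A] by simp

text \<open>Several indices may carry the same monomial; collecting them gives a power series.\<close>

lemma majorizedI:
  fixes c :: "'i \<Rightarrow> real" and p :: "real^'n::finite"
  assumes s: "s > 0"
    and C: "((\<lambda>i. \<bar>c i\<bar> * monomial_at (vec s) (deg i)) has_sum C) I"
    and f: "\<And>x. in_box p s x \<Longrightarrow> ((\<lambda>i. c i * monomial_at (x - p) (deg i)) has_sum f x) I"
  shows "majorized p s f C"
proof -
  define F where "F \<alpha> = {i \<in> I. deg i = \<alpha>}" for \<alpha>
  define a where "a \<alpha> = infsum c (F \<alpha>)" for \<alpha>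
  define w where "w = (monomial_at (vec s) :: ('n \<Rightarrow> nat) \<Rightarrow> real)"
  have w: "w \<alpha> > 0" for \<alpha> using monomial_at_pos[OF s] by (simp add: w_def)
  \<comment> \<open>Summation over I, fibred by the value of \<open>deg\<close>.\<close>
  have reg: "(b has_sum S) UNIV"
    if "(g has_sum S) I" "\<And>\<alpha>. (g has_sum b \<alpha>) (F \<alpha>)" for g :: "'i \<Rightarrow> real" and S b
  proof (rule has_sum_SigmaD)
    have "(g has_sum S) I = ((\<lambda>(\<alpha>, i). g i) has_sum S) (Sigma UNIV F)"
      by (rule has_sum_reindex_bij_witness[where j = "\<lambda>i. (deg i, i)" and i = snd])
         (auto simp: F_def)
    with that(1) show "((\<lambda>(\<alpha>, i). g i) has_sum S) (Sigma UNIV F)" by simp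
  qed (use that(2) in auto)
  have "(\<lambda>i. \<bar>c i\<bar> * w (deg i)) summable_on F \<alpha>" for \<alpha>
    using C unfolding w_def
    by (rule summable_on_subset_banach[OF has_sum_imp_summable]) (auto simp: F_def)
  then have sw: "(\<lambda>i. \<bar>c i\<bar> * w \<alpha>) summable_on F \<alpha>" for \<alpha>
    by (rule summable_on_cong[THEN iffD1, rotated]) (auto simp: F_def)
  \<comment> \<open>On a fibre the weight is a positive constant and can be divided out.\<close>
  have sabs: "(\<lambda>i. \<bar>c i\<bar>) summable_on F \<alpha>" for \<alpha>
    using summable_on_cmult_left[OF sw, of \<alpha> "inverse (w \<alpha>)"] w[of \<alpha>] by (simp add: field_simps)
  then have sc: "(c has_sum a \<alpha>) (F \<alpha>)" for \<alpha>
    unfolding a_def by (rule has_sum_infsum[OF abs_summable_on_real])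
  have ale: "\<bar>a \<alpha>\<bar> \<le> infsum (\<lambda>i. \<bar>c i\<bar>) (F \<alpha>)" for \<alpha>
    unfolding a_def using norm_infsum_bound[of c "F \<alpha>"] sabs by simp
  define b where "b \<alpha> = infsum (\<lambda>i. \<bar>c i\<bar>) (F \<alpha>) * w \<alpha>" for \<alpha>
  have b: "(b has_sum C) UNIV"
  proof (rule reg[OF C])
    fix \<alpha>
    have "((\<lambda>i. \<bar>c i\<bar> * w \<alpha>) has_sum b \<alpha>) (F \<alpha>)"
      unfolding b_def by (intro has_sum_cmult_left has_sum_infsum sabs)
    then show "((\<lambda>i. \<bar>c i\<bar> * monomial_at (vec s) (deg i)) has_sum b \<alpha>) (F \<alpha>)"
      by (rule has_sum_cong[THEN iffD1, rotated]) (auto simp: F_def w_def)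
  qed
  \<comment> \<open>The triangle inequality inside each fibre: collecting coefficients does not
    increase the weighted norm.\<close>
  have leb: "\<bar>a \<alpha>\<bar> * w \<alpha> \<le> b \<alpha>" for \<alpha>
    unfolding b_def using ale w[of \<alpha>] by (intro mult_right_mono) auto
  have sa: "(\<lambda>\<alpha>. \<bar>a \<alpha>\<bar> * w \<alpha>) summable_on UNIV"
    by (rule summable_on_comparison_test[OF has_sum_imp_summable[OF b]])
       (use leb w in \<open>auto simp: less_imp_le\<close>)
  have "infsum (\<lambda>\<alpha>. \<bar>a \<alpha>\<bar> * w \<alpha>) UNIV \<le> C"
    by (rule has_sum_mono[OF has_sum_infsum[OF sa] b]) (rule leb)
  moreover have "((\<lambda>\<alpha>. a \<alpha> * monomial_at (x - p) \<alpha>) has_sum f x) UNIV" if "in_box p s x" for x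
  proof (rule reg[OF f[OF that]])
    fix \<alpha>
    have "((\<lambda>i. c i * monomial_at (x - p) \<alpha>) has_sum a \<alpha> * monomial_at (x - p) \<alpha>) (F \<alpha>)"
      by (intro has_sum_cmult_left sc)
    then show "((\<lambda>i. c i * monomial_at (x - p) (deg i)) has_sum a \<alpha> * monomial_at (x - p) \<alpha>) (F \<alpha>)"
      by (rule has_sum_cong[THEN iffD1, rotated]) (auto simp: F_def)
  qed
  ultimately show ?thesis
    unfolding majorized_def using has_sum_infsum[OF sa] by (auto simp: w_def)
qed

section \<open>Norm estimates for products and infinite sums\<close>

lemma majorized_mono: "majorized p s f C \<Longrightarrow> C \<le> C' \<Longrightarrow> majorized p s f C'"
  unfolding majorized_def by (meson order_trans)

text \<open>The weighted norm dominates the sup norm on the box. In a composition this keeps the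
  inner map inside the box of the outer function.\<close>

lemma majorized_abs_le:
  assumes "majorized p s f C" "in_box p s x"
  shows "\<bar>f x\<bar> \<le> C"
proof -
  from assms obtain a D where D: "D \<le> C"
     "((\<lambda>\<alpha>. \<bar>a \<alpha>\<bar> * monomial_at (vec s) \<alpha>) has_sum D) UNIV"
     "((\<lambda>\<alpha>. a \<alpha> * monomial_at (x - p) \<alpha>) has_sum f x) UNIV"
    unfolding majorized_def by blast
  have "\<bar>a \<alpha> * monomial_at (x - p) \<alpha>\<bar> \<le> \<bar>a \<alpha>\<bar> * monomial_at (vec s) \<alpha>" for \<alpha>
    unfolding abs_mult using assms(2)
    by (intro mult_left_mono abs_monomial_at_le) (auto simp: in_box_def)
  then have b: "a \<alpha> * monomial_at (x - p) \<alpha> \<le> \<bar>a \<alpha>\<bar> * monomial_at (vec s) \<alpha>"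
       "- (a \<alpha> * monomial_at (x - p) \<alpha>) \<le> \<bar>a \<alpha>\<bar> * monomial_at (vec s) \<alpha>" for \<alpha>
    by (smt (verit))+
  have "f x \<le> D" by (rule has_sum_mono[OF D(3,2)]) (rule b)
  moreover have "- f x \<le> D"
  proof (rule has_sum_mono[OF _ D(2)])
    show "((\<lambda>\<alpha>. - (a \<alpha> * monomial_at (x - p) \<alpha>)) has_sum - f x) UNIV"
      using D(3) by (subst has_sum_uminus) simp
  qed (rule b)
  ultimately show ?thesis using D(1) by linarith
qed

lemma majorized_const:
  assumes "s > 0"
  shows "majorized p s (\<lambda>x. c) \<bar>c\<bar>"
  by (rule majorizedI[OF assms, where I = "{()}" and c = "\<lambda>_. c" and deg = "\<lambda>_ _. 0"])
     (auto simp: monomial_at_def has_sum_finite_iff)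

text \<open>Unconditional summability of reals is absolute, which makes the family of products
  summable over the product set.\<close>

lemma has_sum_Times_mult:
  fixes f :: "'a \<Rightarrow> real" and g :: "'b \<Rightarrow> real"
  assumes "(f has_sum x) A" "(g has_sum y) B"
  shows "((\<lambda>(i, j). f i * g j) has_sum x * y) (A \<times> B)"
proof (rule has_sum_SigmaI)
  show "((\<lambda>j. case (i, j) of (i, j) \<Rightarrow> f i * g j) has_sum f i * y) B" for i
    using has_sum_cmult_right[OF assms(2)] by simp
  show "((\<lambda>i. f i * y) has_sum x * y) A" by (rule has_sum_cmult_left[OF assms(1)])
  have f: "(\<lambda>i. norm (f i)) summable_on A" and g: "(\<lambda>i. norm (g i)) summable_on B"
    using assms summable_on_iff_abs_summable_on_real has_sum_imp_summable by blast+
  have "(\<lambda>z. norm (case z of (i, j) \<Rightarrow> f i * g j)) summable_on (A \<times> B)"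
  proof (rule summable_on_SigmaI)
    show "((\<lambda>j. norm (case (i, j) of (i, j) \<Rightarrow> f i * g j)) has_sum
            norm (f i) * infsum (\<lambda>j. norm (g j)) B) B" for i
      using has_sum_cmult_right[OF has_sum_infsum[OF g]] by (simp add: abs_mult)
    show "(\<lambda>i. norm (f i) * infsum (\<lambda>j. norm (g j)) B) summable_on A"
      by (rule summable_on_cmult_left[OF f])
  qed auto
  then show "(\<lambda>(i, j). f i * g j) summable_on A \<times> B"
    using summable_on_iff_abs_summable_on_real by blast
qed

text \<open>The Cauchy product, indexed by pairs of multi-indices; \<open>majorizedI\<close>
  collects the pairs with equal sum. As C and D are only upper bounds of the norms, monotonicity of
  the product of bounds uses \<open>C \<ge> 0\<close>.\<close>

lemma majorized_mult:
  assumes s: "s > 0" and f: "majorized p s f C" and g: "majorized p s g D" and "C \<ge> 0"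
  shows "majorized p s (\<lambda>x. f x * g x) (C * D)"
proof -
  from f obtain a C' where a: "C' \<le> C"
     "((\<lambda>\<alpha>. \<bar>a \<alpha>\<bar> * monomial_at (vec s) \<alpha>) has_sum C') UNIV"
     "\<And>x. in_box p s x \<Longrightarrow> ((\<lambda>\<alpha>. a \<alpha> * monomial_at (x - p) \<alpha>) has_sum f x) UNIV"
    unfolding majorized_def by blast
  from g obtain b D' where b: "D' \<le> D"
     "((\<lambda>\<alpha>. \<bar>b \<alpha>\<bar> * monomial_at (vec s) \<alpha>) has_sum D') UNIV"
     "\<And>x. in_box p s x \<Longrightarrow> ((\<lambda>\<alpha>. b \<alpha> * monomial_at (x - p) \<alpha>) has_sum g x) UNIV"
    unfolding majorized_def by blast
  have "D' \<ge> 0" 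
    by (rule has_sum_nonneg[OF b(2)]) (simp add: monomial_at_nonneg[OF s])
  then have "C' * D' \<le> C * D" using a(1) b(1) \<open>C \<ge> 0\<close> by (intro mult_mono) auto
  moreover have "majorized p s (\<lambda>x. f x * g x) (C' * D')"
  proof (rule majorizedI[OF s, where I = "UNIV \<times> UNIV" and c = "\<lambda>(\<alpha>, \<beta>). a \<alpha> * b \<beta>"
           and deg = "\<lambda>(\<alpha>, \<beta>) i. \<alpha> i + \<beta> i"])
    show "((\<lambda>z. \<bar>case z of (\<alpha>, \<beta>) \<Rightarrow> a \<alpha> * b \<beta>\<bar> *
           monomial_at (vec s) (case z of (\<alpha>, \<beta>) \<Rightarrow> \<lambda>i. \<alpha> i + \<beta> i)) has_sum C' * D') (UNIV \<times> UNIV)"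
      using has_sum_Times_mult[OF a(2) b(2)]
      by (simp add: case_prod_unfold monomial_at_add abs_mult mult_ac)
    show "((\<lambda>z. (case z of (\<alpha>, \<beta>) \<Rightarrow> a \<alpha> * b \<beta>) *
           monomial_at (x - p) (case z of (\<alpha>, \<beta>) \<Rightarrow> \<lambda>i. \<alpha> i + \<beta> i)) has_sum f x * g x) (UNIV \<times> UNIV)"
      if "in_box p s x" for x
      using has_sum_Times_mult[OF a(3) b(3), OF that that]
      by (simp add: case_prod_unfold monomial_at_add mult_ac)
  qed
  ultimately show ?thesis by (rule majorized_mono[rotated])
qed

lemma majorized_power:
  assumes s: "s > 0" and f: "majorized p s f C" and "C \<ge> 0"
  shows "majorized p s (\<lambda>x. f x ^ k) (C ^ k)"
proof (induction k)
  case 0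
  show ?case using majorized_const[OF s, of p 1] by simp
next
  case (Suc k)
  show ?case using majorized_mult[OF s f Suc \<open>C \<ge> 0\<close>] by simp
qed

lemma majorized_prod:
  assumes s: "s > 0" and "finite I" and "\<And>i. i \<in> I \<Longrightarrow> majorized p s (f i) (C i)"
    and "\<And>i. i \<in> I \<Longrightarrow> C i \<ge> 0"
  shows "majorized p s (\<lambda>x. \<Prod>i\<in>I. f i x) (\<Prod>i\<in>I. C i)"
  using assms(2-4)
proof (induction I rule: finite_induct)
  case empty
  show ?case using majorized_const[OF s, of p 1] by simp
next
  case (insert i I)
  then show ?case by (auto intro!: majorized_mult[OF s])
qed

text \<open>The expansions of all the \<open>f k\<close> form one double series over pairs (k,
  \<open>\<alpha>\<close>). It converges absolutely because its norms sum to at most T, and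
  \<open>majorizedI\<close> collects equal monomials.\<close>

lemma majorized_infsum:
  assumes s: "s > 0" and f: "\<And>k. k \<in> K \<Longrightarrow> majorized p s (f k) (C k)"
    and C: "(C has_sum T) K"
    and F: "\<And>x. in_box p s x \<Longrightarrow> ((\<lambda>k. f k x) has_sum F x) K"
  shows "majorized p s F T"
proof -
  define P where "P k a D \<longleftrightarrow> D \<le> C k \<and>
     ((\<lambda>\<alpha>. \<bar>a \<alpha>\<bar> * monomial_at (vec s) \<alpha>) has_sum D) UNIV \<and>
     (\<forall>x. in_box p s x \<longrightarrow> ((\<lambda>\<alpha>. a \<alpha> * monomial_at (x - p) \<alpha>) has_sum f k x) UNIV)" for k a D
  have "\<forall>k\<in>K. \<exists>a D. P k a D" using f unfolding P_def majorized_def by blast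
  then obtain a D where P: "\<And>k. k \<in> K \<Longrightarrow> P k (a k) (D k)" by metis
  have D: "D k \<le> C k" and a: "((\<lambda>\<alpha>. \<bar>a k \<alpha>\<bar> * monomial_at (vec s) \<alpha>) has_sum D k) UNIV"
     if "k \<in> K" for k using P[OF that] by (simp_all add: P_def)
  have af: "((\<lambda>\<alpha>. a k \<alpha> * monomial_at (x - p) \<alpha>) has_sum f k x) UNIV"
    if "k \<in> K" "in_box p s x" for k x using P[OF that(1)] that(2) by (simp add: P_def)
  have D0: "D k \<ge> 0" if "k \<in> K" for k
    by (rule has_sum_nonneg[OF a[OF that]]) (simp add: monomial_at_nonneg[OF s])
  have sD: "D summable_on K"
    by (rule summable_on_comparison_test[OF has_sum_imp_summable[OF C]]) (use D D0 in auto)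
  have le: "infsum D K \<le> T"
    by (rule has_sum_mono[OF has_sum_infsum[OF sD] C]) (use D in auto)
  define c where "c z = a (fst z) (snd z)" for z
  have c: "((\<lambda>\<alpha>. \<bar>c (k, \<alpha>)\<bar> * monomial_at (vec s) (snd (k, \<alpha>))) has_sum D k) UNIV" if "k \<in> K" for k
    using a[OF that] by (simp only: c_def fst_conv snd_conv)
  have cf: "((\<lambda>\<alpha>. c (k, \<alpha>) * monomial_at (x - p) (snd (k, \<alpha>))) has_sum f k x) UNIV"
    if "k \<in> K" "in_box p s x" for k x using af[OF that] by (simp only: c_def fst_conv snd_conv)
  have sabs: "(\<lambda>z. \<bar>c z\<bar> * monomial_at (vec s) (snd z)) summable_on (K \<times> UNIV)"
    by (rule summable_on_SigmaI[OF c sD]) (simp_all add: monomial_at_nonneg[OF s])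
  have "majorized p s F (infsum D K)"
  proof (rule majorizedI[OF s, where I = "K \<times> UNIV" and c = c and deg = snd])
    show "((\<lambda>z. \<bar>c z\<bar> * monomial_at (vec s) (snd z)) has_sum infsum D K) (K \<times> UNIV)"
      by (rule has_sum_SigmaI[OF c has_sum_infsum[OF sD] sabs])
    fix x assume x: "in_box p s x"
    have "(\<lambda>z. \<bar>c z * monomial_at (x - p) (snd z)\<bar>) summable_on (K \<times> UNIV)"
    proof (rule summable_on_comparison_test[OF sabs])
      show "\<bar>c z * monomial_at (x - p) (snd z)\<bar> \<le> \<bar>c z\<bar> * monomial_at (vec s) (snd z)" for z
        unfolding abs_mult using x
        by (intro mult_left_mono abs_monomial_at_le) (simp_all add: in_box_def)
    qed simp
    then have "(\<lambda>z. c z * monomial_at (x - p) (snd z)) summable_on (K \<times> UNIV)"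
      by (rule abs_summable_on_real)
    with cf[OF _ x] F[OF x]
    show "((\<lambda>z. c z * monomial_at (x - p) (snd z)) has_sum F x) (K \<times> UNIV)"
      by (rule has_sum_SigmaI)
  qed
  then show ?thesis using le by (rule majorized_mono)
qed

section \<open>Majorization and analyticity at a point\<close>

lemma monomial_at_vec: "monomial_at (vec s) \<alpha> = s ^ (\<Sum>i\<in>UNIV. \<alpha> i)"
  by (simp add: monomial_at_def power_sum)

lemma monomial_at_upd:
  "monomial_at y (\<alpha>(i := k)) = (y $ i) ^ k * (\<Prod>j\<in>UNIV - {i}. (y $ j) ^ \<alpha> j)"
proof -
  have "monomial_at y (\<alpha>(i := k))
      = (y $ i) ^ (\<alpha>(i := k)) i * (\<Prod>j\<in>UNIV - {i}. (y $ j) ^ (\<alpha>(i := k)) j)"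
    unfolding monomial_at_def by (rule prod.remove) auto
  also have "(\<Prod>j\<in>UNIV - {i}. (y $ j) ^ (\<alpha>(i := k)) j) = (\<Prod>j\<in>UNIV - {i}. (y $ j) ^ \<alpha> j)"
    by (rule prod.cong) auto
  finally show ?thesis by (simp only: fun_upd_same)
qed

lemma ball_imp_in_box: "x \<in> ball p s \<Longrightarrow> in_box p s x"
proof -
  assume "x \<in> ball p s"
  then have "norm (x - p) < s" by (simp add: dist_norm norm_minus_commute)
  then show ?thesis
    unfolding in_box_def using component_le_norm_cart[of "x - p"]
    by (metis less_imp_le order_trans vector_minus_component)
qed

text \<open>\<open>real_analytic_on f {p}\<close> serves as analyticity at p: the centre is the
  single point p, while convergence holds on a whole ball around it.\<close>

lemma majorized_imp_analytic:
  assumes "s > 0" "majorized p s f C"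
  shows "real_analytic_on f {p}"
proof -
  from assms(2) obtain a where
    a: "\<And>x. in_box p s x \<Longrightarrow> ((\<lambda>\<alpha>. a \<alpha> * monomial_at (x - p) \<alpha>) has_sum f x) UNIV"
    unfolding majorized_def by blast
  show ?thesis unfolding real_analytic_on_def
  proof (intro ballI exI conjI)
    fix q x assume "q \<in> {p}" "x \<in> ball q s"
    then show "((\<lambda>\<alpha>. a \<alpha> * (\<Prod>i\<in>UNIV. (x $ i - q $ i) ^ \<alpha> i)) has_sum f x) UNIV"
      using a[OF ball_imp_in_box, of x] by (simp add: monomial_at_def)
  qed (rule assms(1))
qed

lemma analytic_imp_majorized:
  fixes p :: "real^'n::finite"
  assumes "real_analytic_on f {p}"
  obtains s C where "s > 0" "majorized p s f C"
proof -
  from assms have "\<exists>r>0. \<exists>a. \<forall>x\<in>ball p r.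
      ((\<lambda>\<alpha>. a \<alpha> * monomial_at (x - p) \<alpha>) has_sum f x) UNIV"
    unfolding real_analytic_on_def monomial_at_def by (simp only: vector_minus_component) blast
  then obtain r a where r: "r > 0" and
    a: "\<And>x. x \<in> ball p r \<Longrightarrow> ((\<lambda>\<alpha>. a \<alpha> * monomial_at (x - p) \<alpha>) has_sum f x) UNIV"
    by blast
  \<comment> \<open>The l1 bound on the norm is then r / 2, so the closed box lies inside the ball
    of convergence.\<close>
  define s where "s = r / (2 * CARD('n))"
  have s: "s > 0" using r by (simp add: s_def)
  have box: "x \<in> ball p r" if "in_box p s x" for x
  proof -
    have "norm (x - p) \<le> (\<Sum>i\<in>UNIV. \<bar>(x - p) $ i\<bar>)" by (rule norm_le_l1_cart)
    also have "\<dots> \<le> (\<Sum>i\<in>(UNIV::'n set). s)" using that by (intro sum_mono) (auto simp: in_box_def)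
    also have "\<dots> = r / 2" by (simp add: s_def)
    finally show ?thesis using r by (simp add: dist_norm norm_minus_commute)
  qed
  \<comment> \<open>Convergence at the corner of the box is absolute, and the sum of absolute values
    there is the weighted norm.\<close>
  have "in_box p s (p + vec s)" using s by (simp add: in_box_def)
  from has_sum_imp_summable[OF a[OF box[OF this]]]
  have "(\<lambda>\<alpha>. norm (a \<alpha> * monomial_at (vec s) \<alpha>)) summable_on UNIV"
    by (subst summable_on_iff_abs_summable_on_real[symmetric]) simp
  then have "(\<lambda>\<alpha>. \<bar>a \<alpha>\<bar> * monomial_at (vec s) \<alpha>) summable_on UNIV"
    by (simp add: abs_mult monomial_at_nonneg[OF s])
  then have "majorized p s f (infsum (\<lambda>\<alpha>. \<bar>a \<alpha>\<bar> * monomial_at (vec s) \<alpha>) UNIV)"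
    unfolding majorized_def using a box by (intro exI[of _ a] exI conjI order_refl has_sum_infsum) auto
  with s show thesis by (rule that)
qed

lemma majorized_shrink:
  assumes "majorized p s f C" "0 < s'" "s' \<le> s"
  shows "majorized p s' f C"
proof -
  from assms(1) obtain a D where a: "D \<le> C"
     "((\<lambda>\<alpha>. \<bar>a \<alpha>\<bar> * monomial_at (vec s) \<alpha>) has_sum D) UNIV"
     "\<And>x. in_box p s x \<Longrightarrow> ((\<lambda>\<alpha>. a \<alpha> * monomial_at (x - p) \<alpha>) has_sum f x) UNIV"
    unfolding majorized_def by blast
  have le: "\<bar>a \<alpha>\<bar> * monomial_at (vec s') \<alpha> \<le> \<bar>a \<alpha>\<bar> * monomial_at (vec s) \<alpha>" for \<alpha>
    unfolding monomial_at_vec using assms by (intro mult_left_mono power_mono) auto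
  have sm: "(\<lambda>\<alpha>. \<bar>a \<alpha>\<bar> * monomial_at (vec s') \<alpha>) summable_on UNIV"
    by (rule summable_on_comparison_test[OF has_sum_imp_summable[OF a(2)]])
       (simp_all add: le monomial_at_nonneg[OF assms(2)])
  have "infsum (\<lambda>\<alpha>. \<bar>a \<alpha>\<bar> * monomial_at (vec s') \<alpha>) UNIV \<le> D"
    by (rule has_sum_mono[OF has_sum_infsum[OF sm] a(2)]) (rule le)
  moreover have "in_box p s x" if "in_box p s' x" for x
    using that assms(3) unfolding in_box_def by (meson order_trans)
  ultimately show ?thesis
    unfolding majorized_def using a(1,3) has_sum_infsum[OF sm] by (intro exI conjI) auto
qed

text \<open>Removing the constant term leaves monomials of total degree at least 1, on which
  shrinking the radius from s to s' gains the factor s' / s. This makes the inner map of a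
  composition as small as required.\<close>

lemma majorized_diff_center:
  fixes p :: "real^'n::finite"
  assumes "majorized p s f C" "0 < s'" "s' \<le> s"
  shows "majorized p s' (\<lambda>x. f x - f p) (s' / s * C)"
proof -
  from assms(1) obtain a D where a: "D \<le> C"
     "((\<lambda>\<alpha>. \<bar>a \<alpha>\<bar> * monomial_at (vec s) \<alpha>) has_sum D) UNIV"
     "\<And>x. in_box p s x \<Longrightarrow> ((\<lambda>\<alpha>. a \<alpha> * monomial_at (x - p) \<alpha>) has_sum f x) UNIV"
    unfolding majorized_def by blast
  define z where "z = (\<lambda>i::'n. 0::nat)"
  have z: "(\<Sum>i\<in>UNIV. \<alpha> i) > 0" if "\<alpha> \<noteq> z" for \<alpha>
    using that by (auto simp: z_def fun_eq_iff intro!: Nat.gr0I)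
  have mz: "monomial_at y z = 1" for y :: "real^'n" by (simp add: monomial_at_def z_def)
  have mp: "monomial_at (0 :: real^'n) \<alpha> = 0" if "\<alpha> \<noteq> z" for \<alpha>
    using that by (auto simp: monomial_at_def z_def fun_eq_iff)
  \<comment> \<open>Evaluation at the centre isolates the constant coefficient.\<close>
  have "((\<lambda>\<alpha>. a \<alpha> * monomial_at (p - p) \<alpha>) has_sum f p) UNIV"
    using assms by (intro a(3)) (simp add: in_box_def)
  then have "((\<lambda>\<alpha>. a \<alpha> * monomial_at (p - p) \<alpha>) has_sum f p) {z}"
    by (rule has_sum_cong_neutral[THEN iffD1, rotated -1]) (auto simp: mp)
  then have fp: "a z = f p" by (simp add: has_sum_finite_iff mz)
  define b where "b \<alpha> = (if \<alpha> = z then 0 else a \<alpha>)" for \<alpha>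
  have s: "s > 0" using assms by simp
  have le: "\<bar>b \<alpha>\<bar> * monomial_at (vec s') \<alpha> \<le> s' / s * (\<bar>a \<alpha>\<bar> * monomial_at (vec s) \<alpha>)" for \<alpha>
  proof (cases "\<alpha> = z")
    case True
    then show ?thesis using assms s by (simp add: b_def monomial_at_nonneg)
  next
    case False
    define k where "k = (\<Sum>i\<in>UNIV. \<alpha> i)"
    obtain m where m: "k = Suc m" using z[OF False] by (auto simp: k_def gr0_conv_Suc)
    have "s' ^ k \<le> s' / s * s ^ k"
      unfolding m using assms s by (simp add: power_mono)
    then have "\<bar>a \<alpha>\<bar> * s' ^ k \<le> \<bar>a \<alpha>\<bar> * (s' / s * s ^ k)"
      by (rule mult_left_mono) simp
    then show ?thesis using False by (simp add: b_def monomial_at_vec k_def mult_ac)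
  qed
  have sm: "(\<lambda>\<alpha>. \<bar>b \<alpha>\<bar> * monomial_at (vec s') \<alpha>) summable_on UNIV"
    by (rule summable_on_comparison_test[OF summable_on_cmult_right[OF has_sum_imp_summable[OF a(2)]]])
       (rule le, simp add: monomial_at_nonneg[OF assms(2)])
  have "infsum (\<lambda>\<alpha>. \<bar>b \<alpha>\<bar> * monomial_at (vec s') \<alpha>) UNIV \<le> s' / s * D"
    by (rule has_sum_mono[OF has_sum_infsum[OF sm] has_sum_cmult_right[OF a(2)]]) (rule le)
  also have "\<dots> \<le> s' / s * C" using a(1) s assms by (intro mult_left_mono) auto
  finally have "infsum (\<lambda>\<alpha>. \<bar>b \<alpha>\<bar> * monomial_at (vec s') \<alpha>) UNIV \<le> s' / s * C" .
  moreover have "((\<lambda>\<alpha>. b \<alpha> * monomial_at (x - p) \<alpha>) has_sum f x - f p) UNIV"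
    if "in_box p s' x" for x
  proof -
    have "in_box p s x" using that assms(3) unfolding in_box_def by (meson order_trans)
    from a(3)[OF this] have 1: "((\<lambda>\<alpha>. a \<alpha> * monomial_at (x - p) \<alpha>) has_sum f x) UNIV" .
    have "((\<lambda>\<alpha>. a \<alpha> * monomial_at (x - p) \<alpha>) has_sum f p) {z}"
      by (simp add: has_sum_finite_iff mz fp)
    from has_sum_Diff[OF 1 this]
    have "((\<lambda>\<alpha>. a \<alpha> * monomial_at (x - p) \<alpha>) has_sum f x - f p) (UNIV - {z})" by simp
    then show ?thesis
      by (rule has_sum_cong_neutral[THEN iffD1, rotated -1]) (auto simp: b_def)
  qed
  ultimately show ?thesis
    unfolding majorized_def using has_sum_infsum[OF sm] by blast
qed

section \<open>Closure under composition, sums and multiples\<close>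

text \<open>Substitute g into the series of F. The term of index \<open>\<alpha>\<close> has norm at
  most \<open>\<bar>a \<alpha>\<bar> * monomial_at (vec t) \<alpha>\<close> by submultiplicativity,
  and these bounds sum to the norm of F.\<close>

lemma majorized_compose:
  fixes g :: "real^'m::finite \<Rightarrow> real^'n::finite"
  assumes s: "s > 0" and t: "t > 0" and F: "majorized q t F C"
    and g: "\<And>i. majorized p s (\<lambda>x. g x $ i - q $ i) t"
  shows "majorized p s (\<lambda>x. F (g x)) C"
proof -
  from F obtain a D where a: "D \<le> C"
     "((\<lambda>\<alpha>. \<bar>a \<alpha>\<bar> * monomial_at (vec t) \<alpha>) has_sum D) UNIV"
     "\<And>x. in_box q t x \<Longrightarrow> ((\<lambda>\<alpha>. a \<alpha> * monomial_at (x - q) \<alpha>) has_sum F x) UNIV"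
    unfolding majorized_def by blast
  have "majorized p s (\<lambda>x. F (g x)) D"
  proof (rule majorized_infsum[OF s _ a(2)])
    fix \<alpha> :: "'n \<Rightarrow> nat"
    have "majorized p s (\<lambda>x. monomial_at (g x - q) \<alpha>) (monomial_at (vec t) \<alpha>)"
      unfolding monomial_at_def vector_minus_component vec_component using t
      by (intro majorized_prod[OF s] majorized_power[OF s] g) auto
    then show "majorized p s (\<lambda>x. a \<alpha> * monomial_at (g x - q) \<alpha>) (\<bar>a \<alpha>\<bar> * monomial_at (vec t) \<alpha>)"
      by (rule majorized_mult[OF s majorized_const[OF s]]) simp
  next
    fix x assume "in_box p s x"
    then have "in_box q t (g x)" using majorized_abs_le[OF g] by (auto simp: in_box_def)
    then show "((\<lambda>\<alpha>. a \<alpha> * monomial_at (g x - q) \<alpha>) has_sum F (g x)) UNIV" by (rule a(3))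
  qed
  then show ?thesis using a(1) by (rule majorized_mono)
qed

lemma real_analytic_compose:
  fixes g :: "real^'m::finite \<Rightarrow> real^'n::finite"
  assumes F: "real_analytic_on F {g p}" and g: "\<And>i. real_analytic_on (\<lambda>x. g x $ i) {p}"
  shows "real_analytic_on (\<lambda>x. F (g x)) {p}"
proof -
  from F obtain t C where t: "t > 0" "majorized (g p) t F C"
    by (rule analytic_imp_majorized)
  have "\<exists>s B. s > 0 \<and> majorized p s (\<lambda>x. g x $ i) B" for i
    using g[of i] by (metis analytic_imp_majorized)
  then obtain s B where s: "\<And>i. s i > 0" "\<And>i. majorized p (s i) (\<lambda>x. g x $ i) (B i)"
    by metis
  \<comment> \<open>The first entry keeps the new box inside that of each component; the second
    makes \<open>\<sigma> / s i * B i \<le> t\<close>. Adding 1 to \<open>\<bar>B i\<bar>\<close>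
    keeps the denominator positive.\<close>
  define \<sigma> where "\<sigma> = Min (range (\<lambda>i. min (s i) (s i * t / (\<bar>B i\<bar> + 1))))"
  have \<sigma>: "\<sigma> \<le> s i" "\<sigma> \<le> s i * t / (\<bar>B i\<bar> + 1)" for i
  proof -
    have "\<sigma> \<le> min (s i) (s i * t / (\<bar>B i\<bar> + 1))" unfolding \<sigma>_def by (rule Min_le) auto
    then show "\<sigma> \<le> s i" "\<sigma> \<le> s i * t / (\<bar>B i\<bar> + 1)" by auto
  qed
  have \<sigma>0: "\<sigma> > 0" unfolding \<sigma>_def using s t by (subst Min_gr_iff) auto
  have "majorized p \<sigma> (\<lambda>x. g x $ i - g p $ i) t" for i
  proof (rule majorized_mono[OF majorized_diff_center[OF s(2) \<sigma>0 \<sigma>(1)]])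
    have "\<sigma> / s i * B i \<le> \<sigma> / s i * (\<bar>B i\<bar> + 1)"
      using \<sigma>0 s(1)[of i] by (intro mult_left_mono) auto
    also have "\<dots> \<le> t" using \<sigma>(2)[of i] s(1)[of i] by (simp add: field_simps)
    finally show "\<sigma> / s i * B i \<le> t" .
  qed
  from majorized_imp_analytic[OF \<sigma>0 majorized_compose[OF \<sigma>0 t this]] show ?thesis .
qed

lemma real_analytic_on_cong:
  assumes "real_analytic_on f {p}" "open U" "p \<in> U" "\<And>x. x \<in> U \<Longrightarrow> f x = g x"
  shows "real_analytic_on g {p}"
proof -
  obtain r a where r: "r > 0" and
    a: "\<And>x. x \<in> ball p r \<Longrightarrow> ((\<lambda>\<alpha>. a \<alpha> * (\<Prod>i\<in>UNIV. (x $ i - p $ i) ^ \<alpha> i)) has_sum f x) UNIV"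
    using assms(1) unfolding real_analytic_on_def by blast
  from assms(2,3) obtain e where e: "e > 0" "ball p e \<subseteq> U" by (meson open_contains_ball)
  show ?thesis unfolding real_analytic_on_def
  proof (intro ballI exI conjI)
    show "min r e > 0" using r e by simp
    fix q x assume "q \<in> {p}" "x \<in> ball q (min r e)"
    then show "((\<lambda>\<alpha>. a \<alpha> * (\<Prod>i\<in>UNIV. (x $ i - q $ i) ^ \<alpha> i)) has_sum g x) UNIV"
      using a[of x] e(2) assms(4)[of x] by auto
  qed
qed

lemma real_analytic_add:
  assumes "real_analytic_on f {p}" "real_analytic_on g {p}"
  shows "real_analytic_on (\<lambda>x. f x + g x) {p}"
proof -
  from assms obtain s B t C where s: "s > 0" "majorized p s f B" and t: "t > 0" "majorized p t g C"
    by (meson analytic_imp_majorized)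
  define \<sigma> where "\<sigma> = min s t"
  have \<sigma>: "\<sigma> > 0" "\<sigma> \<le> s" "\<sigma> \<le> t" using s t by (auto simp: \<sigma>_def)
  have "majorized p \<sigma> (\<lambda>x. f x + g x) (B + C)"
    \<comment> \<open>A sum of two functions is treated as a series indexed by the two truth
      values.\<close>
    by (rule majorized_infsum[OF \<sigma>(1), where K = UNIV and f = "\<lambda>b. if b then f else g"
          and C = "\<lambda>b. if b then B else C"])
       (use majorized_shrink[OF s(2) \<sigma>(1,2)] majorized_shrink[OF t(2) \<sigma>(1,3)] in
         \<open>auto simp: has_sum_finite_iff UNIV_bool\<close>)
  with \<sigma>(1) show ?thesis by (rule majorized_imp_analytic)
qed

lemma real_analytic_cmult:
  assumes "real_analytic_on f {p}"
  shows "real_analytic_on (\<lambda>x. f x * c) {p}"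
proof -
  from assms obtain s B where s: "s > 0" "majorized p s f B" by (rule analytic_imp_majorized)
  have "majorized p s (\<lambda>x. c * f x) (\<bar>c\<bar> * B)"
    by (rule majorized_mult[OF s(1) majorized_const[OF s(1)] s(2)]) simp
  with s(1) show ?thesis by (simp add: majorized_imp_analytic mult.commute)
qed

lemma real_analytic_sum:
  assumes "finite I" "\<And>i. i \<in> I \<Longrightarrow> real_analytic_on (f i) {p}"
  shows "real_analytic_on (\<lambda>x. \<Sum>i\<in>I. f i x) {p}"
  using assms
proof (induction I rule: finite_induct)
  case empty
  show ?case using majorized_imp_analytic[OF _ majorized_const[of 1 p 0]] by simp
qed (auto intro: real_analytic_add)

section \<open>Termwise differentiation of power series\<close>

text \<open>For \<open>\<alpha> i = 0\<close> the exponent \<open>\<alpha> i - 1\<close> is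
  truncated to 0, which is harmless because the factor \<open>\<alpha> i\<close> vanishes.\<close>

lemma has_derivative_monomial_at:
  fixes p :: "real^'n::finite"
  shows "((\<lambda>x. monomial_at (x - p) \<alpha>) has_derivative
     (\<lambda>h. \<Sum>i\<in>UNIV. h $ i * (\<alpha> i * monomial_at (x - p) (\<alpha>(i := \<alpha> i - 1))))) (at x within S)"
proof -
  have "((\<lambda>x. \<Prod>i\<in>UNIV. (x $ i - p $ i) ^ \<alpha> i) has_derivative
     (\<lambda>h. \<Sum>i\<in>UNIV. (\<alpha> i * (h $ i - 0) * (x $ i - p $ i) ^ (\<alpha> i - 1)) *
        (\<Prod>j\<in>UNIV - {i}. (x $ j - p $ j) ^ \<alpha> j))) (at x within S)"
    by (intro has_derivative_prod has_derivative_power has_derivative_diff has_derivative_const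
         bounded_linear.has_derivative[OF bounded_linear_vec_nth] has_derivative_ident)
  then show ?thesis
    unfolding monomial_at_def[of _ \<alpha>] monomial_at_upd by (simp add: mult_ac)
qed

text \<open>With k the total degree, halving the radius gains a factor \<open>2 ^ k\<close> in the
  denominator, which absorbs the exponent brought down by differentiation:
  \<open>\<alpha> i \<le> k < 2 ^ k\<close>.\<close>

lemma monomial_at_derivative_le:
  fixes \<alpha> :: "'n::finite \<Rightarrow> nat"
  assumes "s > 0"
  shows "\<alpha> i * monomial_at (vec (s / 2)) (\<alpha>(i := \<alpha> i - 1)) \<le> 2 / s * monomial_at (vec s) \<alpha>"
proof (cases "\<alpha> i = 0")
  case True
  then show ?thesis using assms by (simp add: monomial_at_nonneg)
next
  case False
  define k where "k = (\<Sum>j\<in>UNIV. \<alpha> j)"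
  have "\<alpha> i \<le> k" unfolding k_def by (rule member_le_sum) auto
  then have "\<alpha> i \<le> 2 ^ k" using less_exp[of k] by linarith
  then have "real (\<alpha> i) \<le> 2 ^ k" by (metis of_nat_le_iff of_nat_numeral of_nat_power)
  have e: "s / 2 * (s / 2) ^ (\<alpha> i - 1) = (s / 2) ^ \<alpha> i"
    using False by (cases "\<alpha> i") simp_all
  have "s / 2 * monomial_at (vec (s / 2)) (\<alpha>(i := \<alpha> i - 1)) = monomial_at (vec (s / 2)) (\<alpha>(i := \<alpha> i))"
    unfolding monomial_at_upd vec_component by (simp only: mult.assoc[symmetric] e)
  also have "\<dots> = (s / 2) ^ k" by (simp add: monomial_at_vec k_def)
  finally have "s / 2 * (\<alpha> i * monomial_at (vec (s / 2)) (\<alpha>(i := \<alpha> i - 1))) = \<alpha> i * (s / 2) ^ k"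
    by simp
  also have "\<dots> \<le> 2 ^ k * (s / 2) ^ k"
    using \<open>real (\<alpha> i) \<le> 2 ^ k\<close> assms by (intro mult_right_mono) auto
  also have "\<dots> = s ^ k" by (simp add: power_divide)
  finally have "s / 2 * (\<alpha> i * monomial_at (vec (s / 2)) (\<alpha>(i := \<alpha> i - 1))) \<le> monomial_at (vec s) \<alpha>"
    by (simp add: monomial_at_vec k_def)
  then show ?thesis using assms by (simp add: field_simps)
qed

text \<open>On the half box the termwise partial derivatives are dominated by 2 / s times the series
  of norms of f. This bounds their norms and also gives the uniform convergence that justifies
  differentiating under the sum.\<close>

lemma majorized_derivative:
  fixes p :: "real^'n::finite"
  assumes s: "s > 0" and f: "majorized p s f C"
  obtains G where "\<And>i. majorized p (s / 2) (G i) (2 / s * C)"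
    "\<And>x. x \<in> ball p (s / 2) \<Longrightarrow> (f has_derivative (\<lambda>h. \<Sum>i\<in>UNIV. h $ i * G i x)) (at x)"
proof -
  from f obtain a D where a: "D \<le> C"
     "((\<lambda>\<alpha>. \<bar>a \<alpha>\<bar> * monomial_at (vec s) \<alpha>) has_sum D) UNIV"
     "\<And>x. in_box p s x \<Longrightarrow> ((\<lambda>\<alpha>. a \<alpha> * monomial_at (x - p) \<alpha>) has_sum f x) UNIV"
    unfolding majorized_def by blast
  define M where "M \<alpha> = 2 / s * (\<bar>a \<alpha>\<bar> * monomial_at (vec s) \<alpha>)" for \<alpha>
  define S where "S = ball p (s / 2)"
  define d where "d i \<alpha> = \<alpha>(i := \<alpha> i - 1)" for i :: 'n and \<alpha> :: "'n \<Rightarrow> nat"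
  define c where "c i \<alpha> = a \<alpha> * real (\<alpha> i)" for i :: 'n and \<alpha> :: "'n \<Rightarrow> nat"
  define T where "T i x \<alpha> = c i \<alpha> * monomial_at (x - p) (d i \<alpha>)" for i x \<alpha>
  define G where "G i x = infsum (T i x) UNIV" for i x
  have s2: "s / 2 > 0" using s by simp
  have M: "(M has_sum 2 / s * D) UNIV" unfolding M_def by (rule has_sum_cmult_right[OF a(2)])
  have cM: "\<bar>c i \<alpha>\<bar> * monomial_at (vec (s / 2)) (d i \<alpha>) \<le> M \<alpha>" for i \<alpha>
    using mult_left_mono[OF monomial_at_derivative_le[OF s, of \<alpha> i], of "\<bar>a \<alpha>\<bar>"]
    by (simp add: M_def c_def d_def abs_mult mult_ac)
  have TM: "\<bar>T i x \<alpha>\<bar> \<le> M \<alpha>" if "in_box p (s / 2) x" for i x \<alpha>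
  proof -
    have "\<bar>T i x \<alpha>\<bar> \<le> \<bar>c i \<alpha>\<bar> * monomial_at (vec (s / 2)) (d i \<alpha>)"
      unfolding T_def abs_mult using that
      by (intro mult_left_mono abs_monomial_at_le) (auto simp: in_box_def)
    then show ?thesis using cM by (rule order_trans)
  qed
  have TG: "(T i x has_sum G i x) UNIV" if "in_box p (s / 2) x" for i x
  proof -
    have "(\<lambda>\<alpha>. \<bar>T i x \<alpha>\<bar>) summable_on UNIV"
      by (rule summable_on_comparison_test[OF has_sum_imp_summable[OF M]]) (simp_all add: TM[OF that])
    then show ?thesis unfolding G_def by (rule has_sum_infsum[OF abs_summable_on_real])
  qed
  have "majorized p (s / 2) (G i) (2 / s * C)" for i
  proof -
    have sm: "(\<lambda>\<alpha>. \<bar>c i \<alpha>\<bar> * monomial_at (vec (s / 2)) (d i \<alpha>)) summable_on UNIV"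
      by (rule summable_on_comparison_test[OF has_sum_imp_summable[OF M]])
         (simp_all add: cM monomial_at_nonneg[OF s2])
    \<comment> \<open>The degree map \<open>d i\<close> is not injective: exponents 0 and 1 at i
      both become 0. \<open>majorizedI\<close> allows for this.\<close>
    have "majorized p (s / 2) (G i) (infsum (\<lambda>\<alpha>. \<bar>c i \<alpha>\<bar> * monomial_at (vec (s / 2)) (d i \<alpha>)) UNIV)"
      by (rule majorizedI[OF s2 has_sum_infsum[OF sm]]) (use TG in \<open>simp add: T_def[abs_def]\<close>)
    moreover have "infsum (\<lambda>\<alpha>. \<bar>c i \<alpha>\<bar> * monomial_at (vec (s / 2)) (d i \<alpha>)) UNIV \<le> 2 / s * D"
      by (rule has_sum_mono[OF has_sum_infsum[OF sm] M]) (rule cM)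
    moreover have "2 / s * D \<le> 2 / s * C" using a(1) s by (intro mult_left_mono) auto
    ultimately show ?thesis by (meson majorized_mono order_trans)
  qed
  moreover have "(f has_derivative (\<lambda>h. \<Sum>i\<in>UNIV. h $ i * G i x)) (at x)" if "x \<in> ball p (s / 2)" for x
  proof -
    \<comment> \<open>The theorems on series of functions are indexed by natural numbers, so the
      multi-indices are enumerated; absolute convergence makes the order immaterial.\<close>
    define e where "e = from_nat_into (UNIV :: ('n \<Rightarrow> nat) set)"
    have "infinite (UNIV :: ('n \<Rightarrow> nat) set)"
      by (simp add: infinite_UNIV_char_0 finite_UNIV_fun finite_UNIV_fun)
    then have e: "bij_betw e UNIV UNIV"
      unfolding e_def by (intro bij_betw_from_nat_into) auto
    have sums: "(\<lambda>n. g (e n)) sums y" if "(g has_sum y) UNIV" for g :: "('n \<Rightarrow> nat) \<Rightarrow> real" and y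
      using that has_sum_reindex_bij_betw[OF e, of g y] by (intro has_sum_imp_sums) simp
    have box: "in_box p (s / 2) x" "in_box p s x" if "x \<in> S" for x
      using ball_imp_in_box[of x p "s / 2"] ball_imp_in_box[of x p s] that s by (auto simp: S_def)
    have unif: "uniform_limit S (\<lambda>n x. \<Sum>k<n. T i x (e k)) (\<lambda>x. \<Sum>k. T i x (e k)) sequentially" for i
    proof (rule Weierstrass_m_test)
      show "norm (T i x (e n)) \<le> M (e n)" if "x \<in> S" for n x
        using TM[OF box(1)[OF that]] by simp
      show "summable (\<lambda>n. M (e n))" using sums[OF M] by (rule sums_summable)
    qed
    have suminf: "(\<Sum>k. T i x (e k)) = G i x" if "x \<in> S" for i x
      using sums[OF TG[OF box(1)[OF that]]] by (rule sums_unique[symmetric])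
    \<comment> \<open>Needed are a convex domain, convergence at the one point p and uniform
      convergence of the derivatives. The limit g is identified with f afterwards, by uniqueness of
      sums.\<close>
    have "\<exists>g. \<forall>x\<in>S. (\<lambda>n. a (e n) * monomial_at (x - p) (e n)) sums g x \<and>
        (g has_derivative (\<lambda>h. \<Sum>i\<in>UNIV. h $ i * G i x)) (at x within S)"
    proof (rule has_derivative_series)
      show "convex S" by (simp add: S_def)
      show "p \<in> S" using s by (simp add: S_def)
      then show "(\<lambda>n. a (e n) * monomial_at (p - p) (e n)) sums f p"
        by (intro sums[OF a(3)] box)
      show "((\<lambda>x. a (e n) * monomial_at (x - p) (e n)) has_derivative
          (\<lambda>h. \<Sum>i\<in>UNIV. h $ i * T i x (e n))) (at x within S)" for n x
        using has_derivative_mult_right[OF has_derivative_monomial_at, of "a (e n)" p "e n" x S]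
        by (simp add: T_def c_def d_def sum_distrib_left mult_ac)
      fix \<epsilon> :: real assume \<epsilon>: "\<epsilon> > 0"
      \<comment> \<open>Each of the n coordinates contributes at most
        \<open>norm h * \<delta>\<close> to the error.\<close>
      define \<delta> where "\<delta> = \<epsilon> / CARD('n)"
      have \<delta>: "\<delta> > 0" using \<epsilon> by (simp add: \<delta>_def)
      have "\<forall>\<^sub>F n in sequentially. \<forall>i. \<forall>x\<in>S. dist (\<Sum>k<n. T i x (e k)) (\<Sum>k. T i x (e k)) < \<delta>"
        using unif \<delta> by (intro eventually_all_finite) (auto simp: uniform_limit_iff)
      then show "\<forall>\<^sub>F n in sequentially. \<forall>x\<in>S. \<forall>h.
         norm ((\<Sum>k<n. \<Sum>i\<in>UNIV. h $ i * T i x (e k)) - (\<Sum>i\<in>UNIV. h $ i * G i x)) \<le> \<epsilon> * norm h"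
      proof (rule eventually_mono, intro ballI allI)
        fix n x and h :: "real^'n"
        assume n: "\<forall>i. \<forall>x\<in>S. dist (\<Sum>k<n. T i x (e k)) (\<Sum>k. T i x (e k)) < \<delta>" and x: "x \<in> S"
        have "(\<Sum>k<n. \<Sum>i\<in>UNIV. h $ i * T i x (e k)) - (\<Sum>i\<in>UNIV. h $ i * G i x)
            = (\<Sum>i\<in>UNIV. h $ i * ((\<Sum>k<n. T i x (e k)) - G i x))"
          by (subst sum.swap) (simp add: sum_subtractf right_diff_distrib sum_distrib_left)
        also have "norm \<dots> \<le> (\<Sum>i\<in>(UNIV::'n set). norm h * \<delta>)"
        proof (rule sum_norm_le)
          fix i
          have "\<bar>(\<Sum>k<n. T i x (e k)) - G i x\<bar> \<le> \<delta>"
            using n[rule_format, OF x, of i] suminf[OF x, of i] by (simp add: dist_real_def)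
          then show "norm (h $ i * ((\<Sum>k<n. T i x (e k)) - G i x)) \<le> norm h * \<delta>"
            unfolding norm_mult using component_le_norm_cart[of h i] by (intro mult_mono) auto
        qed
        also have "\<dots> = \<epsilon> * norm h" by (simp add: \<delta>_def)
        finally show "norm ((\<Sum>k<n. \<Sum>i\<in>UNIV. h $ i * T i x (e k)) - (\<Sum>i\<in>UNIV. h $ i * G i x))
          \<le> \<epsilon> * norm h" .
      qed
    qed
    then obtain g where g: "\<And>x. x \<in> S \<Longrightarrow> (\<lambda>n. a (e n) * monomial_at (x - p) (e n)) sums g x"
        "\<And>x. x \<in> S \<Longrightarrow> (g has_derivative (\<lambda>h. \<Sum>i\<in>UNIV. h $ i * G i x)) (at x within S)"
      by blast
    have gf: "g y = f y" if "y \<in> S" for y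
    proof (rule sums_unique2[OF g(1)[OF that]])
      show "(\<lambda>n. a (e n) * monomial_at (y - p) (e n)) sums f y"
        by (rule sums[OF a(3)[OF box(2)[OF that]]])
    qed
    have S: "open S" "x \<in> S" using that by (auto simp: S_def)
    have "(g has_derivative (\<lambda>h. \<Sum>i\<in>UNIV. h $ i * G i x)) (at x)"
      using g(2)[OF S(2)] unfolding at_within_open[OF S(2,1)] .
    then show ?thesis using S gf by (rule has_derivative_transform_within_open)
  qed
  ultimately show thesis by (rule that)
qed

lemma real_analytic_differentiable:
  assumes "real_analytic_on f {p}"
  shows "f differentiable (at p)"
proof -
  from assms obtain s C where s: "s > 0" "majorized p s f C" by (rule analytic_imp_majorized)
  from majorized_derivative[OF this] obtain G where
    "\<And>x. x \<in> ball p (s / 2) \<Longrightarrow> (f has_derivative (\<lambda>h. \<Sum>i\<in>UNIV. h $ i * G i x)) (at x)"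
    by blast
  from this[of p] s(1) show ?thesis by (intro differentiableI) auto
qed

lemma real_analytic_partial_derivative:
  fixes p :: "real^'n::finite"
  assumes "real_analytic_on f {p}"
  shows "real_analytic_on (\<lambda>x. frechet_derivative f (at x) (axis i 1)) {p}"
proof -
  from assms obtain s C where s: "s > 0" "majorized p s f C" by (rule analytic_imp_majorized)
  from majorized_derivative[OF this] obtain G where
    G: "\<And>i. majorized p (s / 2) (G i) (2 / s * C)"
    "\<And>x. x \<in> ball p (s / 2) \<Longrightarrow> (f has_derivative (\<lambda>h. \<Sum>i\<in>UNIV. h $ i * G i x)) (at x)"
    by blast
  have s2: "s / 2 > 0" using s by simp
  show ?thesis
  proof (rule real_analytic_on_cong[OF majorized_imp_analytic[OF s2 G(1)]])
    show "open (ball p (s / 2))" "p \<in> ball p (s / 2)" using s2 by auto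
    fix x assume "x \<in> ball p (s / 2)"
    from frechet_derivative_at[OF G(2)[OF this], symmetric]
    show "G i x = frechet_derivative f (at x) (axis i 1)"
      by (simp add: axis_def if_distrib[of "\<lambda>z. z * _"] cong: if_cong)
  qed
qed

section \<open>Computations in a chart\<close>

lemma real_analytic_on_pointwise: "real_analytic_on f S \<longleftrightarrow> (\<forall>x\<in>S. real_analytic_on f {x})"
  by (simp add: real_analytic_on_def)

lemma differentiable_cart:
  fixes f :: "'a::real_normed_vector \<Rightarrow> 'b::euclidean_space^'n::finite"
  assumes "\<And>i. (\<lambda>x. f x $ i) differentiable (at a)"
  shows "f differentiable (at a)"
proof -
  have "(\<lambda>x. f x \<bullet> b) differentiable (at a)" if "b \<in> Basis" for b
  proof -
    from that have "\<exists>i u. b = axis i u" by (auto simp: Basis_vec_def)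
    then obtain i u where b: "b = axis i u" by blast
    from assms[of i] obtain D where "((\<lambda>x. f x $ i) has_derivative D) (at a)"
      unfolding differentiable_def by blast
    from has_derivative_inner_left[OF this, of u]
    have "((\<lambda>x. f x \<bullet> b) has_derivative (\<lambda>x. D x \<bullet> u)) (at a)"
      by (simp add: b inner_axis)
    then show ?thesis by (rule differentiableI)
  qed
  then show ?thesis by (simp add: differentiable_componentwise_within[of f])
qed

lemma bounded_bilinear_matrix_vector_mult:
  "bounded_bilinear ((*v) :: real^'n::finite^'m::finite \<Rightarrow> real^'n \<Rightarrow> real^'m)"
  unfolding bilinear_conv_bounded_bilinear[symmetric] bilinear_def
  by (auto intro!: linearI simp: matrix_vector_mult_add_rdistrib scaleR_matrix_vector_assoc[symmetric])

lemma bounded_bilinear_matrix_matrix_mult: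
  "bounded_bilinear ((**) :: real^'n::finite^'m::finite \<Rightarrow> real^'k::finite^'n \<Rightarrow> real^'k^'m)"
  unfolding bilinear_conv_bounded_bilinear[symmetric] bilinear_def
  by (auto intro!: linearI simp: matrix_matrix_mult_def vec_eq_iff sum.distrib sum_distrib_left
      distrib_left distrib_right mult_ac)

lemma bounded_linear_trace: "bounded_linear (trace :: real^'n::finite^'n \<Rightarrow> real)"
  by (rule linear_conv_bounded_linear[THEN iffD1]) (auto intro!: linearI simp: trace_add trace_scaleR)

text \<open>One chart is singled out for all computations; statements about further charts come from
  interpreting the locale again.\<close>

locale analytic_chart =
  fixes \<A> :: "('m :: {t2_space, second_countable_topology}, 'n :: finite) chart set"
    and c :: "('m, 'n) chart"
  assumes atlas: "analytic_atlas \<A>" and chart: "c \<in> \<A>"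
begin

lemma
  shows open_chart_dom: "open (chart_dom c)"
    and chart_image: "open (chart_map c ` chart_dom c)"
    and chart_homeomorphism:
      "homeomorphism (chart_dom c) (chart_map c ` chart_dom c) (chart_map c) (chart_inv c)"
  using atlas chart unfolding analytic_atlas_def by blast+

lemma analytic_transition:
  assumes "d \<in> \<A>" "x \<in> chart_map c ` (chart_dom c \<inter> chart_dom d)"
  shows "real_analytic_on (\<lambda>x. transition c d x $ i) {x}"
proof -
  have "real_analytic_on (\<lambda>x. transition c d x $ i) (chart_map c ` (chart_dom c \<inter> chart_dom d))"
    using atlas chart assms(1) unfolding analytic_atlas_def by blast
  then show ?thesis using assms(2) by (subst (asm) real_analytic_on_pointwise) (rule bspec)
qed

lemma chart_inv_chart_map: "p \<in> chart_dom c \<Longrightarrow> chart_inv c (chart_map c p) = p"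
  by (rule homeomorphism_apply1[OF chart_homeomorphism])

lemma chart_map_chart_inv: "x \<in> chart_map c ` chart_dom c \<Longrightarrow> chart_map c (chart_inv c x) = x"
  by (rule homeomorphism_apply2[OF chart_homeomorphism])

lemma open_chart_image:
  assumes "open W"
  shows "open (chart_map c ` (chart_dom c \<inter> W))"
proof (rule openin_open_trans[OF _ chart_image])
  show "openin (top_of_set (chart_map c ` chart_dom c)) (chart_map c ` (chart_dom c \<inter> W))"
    by (rule homeomorphism_imp_open_map[OF chart_homeomorphism openin_open_Int[OF assms]])
qed

lemma lie_bracket_eq:
  assumes "((\<lambda>x. \<xi> c (chart_inv c x)) has_derivative X) (at (chart_map c p))"
    and "((\<lambda>x. \<eta> c (chart_inv c x)) has_derivative Y) (at (chart_map c p))"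
  shows "lie_bracket \<xi> \<eta> c p = Y (\<xi> c p) - X (\<eta> c p)"
  unfolding lie_bracket_def using assms[THEN frechet_derivative_at] by simp

lemma has_derivative_apply_field:
  assumes "p \<in> chart_dom c"
    and "((\<lambda>x. A c (chart_inv c x)) has_derivative D) (at (chart_map c p))"
    and "((\<lambda>x. \<xi> c (chart_inv c x)) has_derivative X) (at (chart_map c p))"
  shows "((\<lambda>x. apply_field A \<xi> c (chart_inv c x)) has_derivative
     (\<lambda>h. A c p *v X h + D h *v \<xi> c p)) (at (chart_map c p))"
  unfolding apply_field_def
  using bounded_bilinear.FDERIV[OF bounded_bilinear_matrix_vector_mult assms(2,3)]
  by (simp add: chart_inv_chart_map[OF assms(1)])

text \<open>By the product rule, the terms containing the derivatives X and Y of the fields cancel,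
  which is the tensoriality of the torsion; only the derivative of L remains.\<close>

lemma nijenhuis_torsion_eq:
  assumes p: "p \<in> chart_dom c"
    and D: "((\<lambda>x. L c (chart_inv c x)) has_derivative D) (at (chart_map c p))"
    and X: "((\<lambda>x. \<xi> c (chart_inv c x)) has_derivative X) (at (chart_map c p))"
    and Y: "((\<lambda>x. \<eta> c (chart_inv c x)) has_derivative Y) (at (chart_map c p))"
  shows "nijenhuis_torsion L \<xi> \<eta> c p = torsion_at (L c p) D (\<xi> c p) (\<eta> c p)"
proof -
  note LX = has_derivative_apply_field[where A = L and \<xi> = \<xi>, OF p D X] and LY = has_derivative_apply_field[where A = L and \<xi> = \<eta>, OF p D Y]
  show ?thesis
    unfolding nijenhuis_torsion_def torsion_at_def
      lie_bracket_eq[where \<xi> = \<xi> and \<eta> = \<eta>, OF X Y]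
      lie_bracket_eq[where \<xi> = "apply_field L \<xi>" and \<eta> = \<eta>, OF LX Y]
      lie_bracket_eq[where \<xi> = \<xi> and \<eta> = "apply_field L \<eta>", OF X LY]
      lie_bracket_eq[where \<xi> = "apply_field L \<xi>" and \<eta> = "apply_field L \<eta>", OF LX LY]
    by (simp add: apply_field_def matrix_vector_right_distrib matrix_vector_mult_diff_distrib)
qed

lemma bracket_form_constant:
  assumes p: "p \<in> chart_dom c"
    and A: "((\<lambda>x. A c (chart_inv c x)) has_derivative D) (at (chart_map c p))"
    and B: "((\<lambda>x. B c (chart_inv c x)) has_derivative E) (at (chart_map c p))"
    and X: "((\<lambda>x. \<xi> c (chart_inv c x)) has_derivative (\<lambda>h. 0)) (at (chart_map c p))"
    and v: "\<xi> c p = v"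
  shows "bracket_form A B \<xi> c p = E (A c p *v v) *v v - D (B c p *v v) *v v
     + B c p *v (D v *v v) - A c p *v (E v *v v)"
proof -
  note AX = has_derivative_apply_field[where A = A and \<xi> = \<xi>, OF p A X] and BX = has_derivative_apply_field[where A = B and \<xi> = \<xi>, OF p B X]
  show ?thesis
    unfolding bracket_form_def
      lie_bracket_eq[where \<xi> = "apply_field A \<xi>" and \<eta> = \<xi>, OF AX X]
      lie_bracket_eq[where \<xi> = \<xi> and \<eta> = "apply_field B \<xi>", OF X BX]
      lie_bracket_eq[where \<xi> = "apply_field A \<xi>" and \<eta> = "apply_field B \<xi>", OF AX BX]
    by (simp add: apply_field_def v matrix_vector_mult_diff_distrib linear_neg[OF matrix_vector_mul_linear])
qed

lemma analytic_tensor_field_derivative: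
  assumes "analytic_tensor_field \<A> L" "p \<in> chart_dom c"
  obtains D where "((\<lambda>x. L c (chart_inv c x)) has_derivative D) (at (chart_map c p))" "linear D"
proof -
  have "real_analytic_on (\<lambda>x. L c (chart_inv c x) $ i $ j) (chart_map c ` chart_dom c)" for i j
    using assms(1)[unfolded analytic_tensor_field_def, THEN conjunct1] chart by blast
  then have "real_analytic_on (\<lambda>x. L c (chart_inv c x) $ i $ j) {chart_map c p}" for i j
    using assms(2) by (subst (asm) real_analytic_on_pointwise) blast
  then have "(\<lambda>x. L c (chart_inv c x)) differentiable (at (chart_map c p))"
    by (intro differentiable_cart real_analytic_differentiable)
  then obtain D where "((\<lambda>x. L c (chart_inv c x)) has_derivative D) (at (chart_map c p))"
    by (auto simp: differentiable_def)
  then show thesis using that has_derivative_linear by blast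
qed

lemma analytic_vector_field_derivative:
  assumes "analytic_vector_field \<A> W \<xi>" "p \<in> chart_dom c \<inter> W"
  obtains X where "((\<lambda>x. \<xi> c (chart_inv c x)) has_derivative X) (at (chart_map c p))"
proof -
  have "real_analytic_on (\<lambda>x. \<xi> c (chart_inv c x) $ i) (chart_map c ` (chart_dom c \<inter> W))" for i
    using assms(1)[unfolded analytic_vector_field_def, THEN conjunct1] chart by blast
  then have "real_analytic_on (\<lambda>x. \<xi> c (chart_inv c x) $ i) {chart_map c p}" for i
    using assms(2) by (subst (asm) real_analytic_on_pointwise) blast
  then have "(\<lambda>x. \<xi> c (chart_inv c x)) differentiable (at (chart_map c p))"
    by (intro differentiable_cart real_analytic_differentiable)
  then show thesis using that by (auto simp: differentiable_def)
qed

section \<open>Jacobians of chart changes and vector fields constant in one chart\<close>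

lemma transition_has_derivative:
  assumes d: "d \<in> \<A>" and p: "p \<in> chart_dom c \<inter> chart_dom d"
  shows "(transition c d has_derivative (\<lambda>h. chart_jacobian c d p *v h)) (at (chart_map c p))"
proof -
  have "real_analytic_on (\<lambda>x. transition c d x $ i) {chart_map c p}" for i
    by (rule analytic_transition[OF d]) (use p in blast)
  then have "transition c d differentiable (at (chart_map c p))"
    by (intro differentiable_cart real_analytic_differentiable)
  then show ?thesis unfolding chart_jacobian_def using jacobian_works by blast
qed

lemma chart_jacobian_self:
  assumes p: "p \<in> chart_dom c"
  shows "chart_jacobian c c p = mat 1"
proof -
  have "(transition c c has_derivative (\<lambda>h. chart_jacobian c c p *v h)) (at (chart_map c p))"
    using transition_has_derivative[OF chart, of p] p by simp
  then have "((\<lambda>x. x) has_derivative (\<lambda>h. chart_jacobian c c p *v h)) (at (chart_map c p))"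
    using chart_image
    by (rule has_derivative_transform_within_open)
       (use p in \<open>auto simp: transition_def chart_map_chart_inv chart_inv_chart_map\<close>)
  then have "(\<lambda>h. chart_jacobian c c p *v h) = (\<lambda>h. h)"
    using has_derivative_unique has_derivative_ident by blast
  then have "chart_jacobian c c p *v h = mat 1 *v h" for h by (simp add: fun_eq_iff)
  then show ?thesis by (subst matrix_eq) blast
qed

text \<open>The field with constant components v in the chart c, carried to the other charts by the
  transformation law. Such fields are the test fields for the bracket conditions.\<close>

definition coordinate_field :: "real^'n \<Rightarrow> ('m, 'n) vfield" where
  "coordinate_field v = (\<lambda>d p. chart_jacobian c d p *v v)"

lemma coordinate_field_self: "p \<in> chart_dom c \<Longrightarrow> coordinate_field v c p = v"
  by (simp add: coordinate_field_def chart_jacobian_self)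

lemma coordinate_field_derivative:
  assumes "p \<in> chart_dom c"
  shows "((\<lambda>x. coordinate_field v c (chart_inv c x)) has_derivative (\<lambda>h. 0)) (at (chart_map c p))"
proof -
  from has_derivative_const chart_image show ?thesis
    by (rule has_derivative_transform_within_open[where f = "\<lambda>x. v"])
       (use assms in \<open>auto simp: coordinate_field_self chart_inv_chart_map\<close>)
qed

text \<open>The chain rule, applied on the triple overlap, whose image is open and where the two
  transitions compose to the third. It yields the transformation law of
  \<open>coordinate_field\<close>.\<close>

lemma chart_jacobian_compose:
  assumes d: "d \<in> \<A>" and e: "e \<in> \<A>" and p: "p \<in> chart_dom c \<inter> chart_dom d \<inter> chart_dom e"
  shows "chart_jacobian c e p = chart_jacobian d e p ** chart_jacobian c d p"
proof -
  interpret d: analytic_chart \<A> d by unfold_locales (rule atlas d)+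
  interpret e: analytic_chart \<A> e by unfold_locales (rule atlas e)+
  define U where "U = chart_map c ` (chart_dom c \<inter> (chart_dom d \<inter> chart_dom e))"
  have U: "open U" "chart_map c p \<in> U"
    using p unfolding U_def
    by (auto intro!: open_chart_image open_Int d.open_chart_dom e.open_chart_dom)
  have x: "transition c d (chart_map c p) = chart_map d p"
    using p by (simp add: transition_def chart_inv_chart_map)
  have "(transition d e \<circ> transition c d has_derivative
     (*v) (chart_jacobian d e p) \<circ> (*v) (chart_jacobian c d p)) (at (chart_map c p))"
    using p x transition_has_derivative[OF d, of p] d.transition_has_derivative[OF e, of p]
    by (intro diff_chain_at) simp_all
  then have "(transition c e has_derivative
     (*v) (chart_jacobian d e p) \<circ> (*v) (chart_jacobian c d p)) (at (chart_map c p))"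
    using U
  proof (rule has_derivative_transform_within_open)
    fix x assume "x \<in> U"
    then obtain q where "q \<in> chart_dom c \<inter> (chart_dom d \<inter> chart_dom e)" "x = chart_map c q"
      by (auto simp: U_def)
    then show "(transition d e \<circ> transition c d) x = transition c e x"
      by (simp add: transition_def chart_inv_chart_map d.chart_inv_chart_map)
  qed
  moreover have "(transition c e has_derivative (*v) (chart_jacobian c e p)) (at (chart_map c p))"
    using transition_has_derivative[OF e, of p] p by simp
  ultimately have "(*v) (chart_jacobian c e p) = (*v) (chart_jacobian d e p) \<circ> (*v) (chart_jacobian c d p)"
    by (rule has_derivative_unique[symmetric])
  then show ?thesis by (subst matrix_eq) (simp add: fun_eq_iff matrix_vector_mul_assoc)
qed

text \<open>The components in a chart d are combinations of partial derivatives of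
  \<open>transition c d\<close>, which are functions of the coordinates of c. Reading them in the
  coordinates of d means composing with \<open>transition d c\<close>.\<close>

lemma analytic_coordinate_field: "analytic_vector_field \<A> (chart_dom c) (coordinate_field v)"
  unfolding analytic_vector_field_def
proof (intro conjI ballI allI)
  fix d e p assume "d \<in> \<A>" "e \<in> \<A>" "p \<in> chart_dom d \<inter> chart_dom e \<inter> chart_dom c"
  then show "coordinate_field v e p = chart_jacobian d e p *v coordinate_field v d p"
    using chart_jacobian_compose[of d e p]
    by (simp add: coordinate_field_def matrix_vector_mul_assoc)
next
  fix d i assume d: "d \<in> \<A>"
  interpret d: analytic_chart \<A> d by unfold_locales (rule atlas d)+
  define U where "U = chart_map d ` (chart_dom d \<inter> chart_dom c)"
  have U: "open U" unfolding U_def by (rule d.open_chart_image[OF open_chart_dom])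
  define F where "F j x = frechet_derivative (\<lambda>z. transition c d z $ i) (at x) (axis j 1)" for j x
  have F: "chart_jacobian c d q $ i $ j = F j (chart_map c q)" if "q \<in> chart_dom c \<inter> chart_dom d" for q j
  proof -
    have "((\<lambda>z. transition c d z $ i) has_derivative (\<lambda>h. (chart_jacobian c d q *v h) $ i)) (at (chart_map c q))"
      by (rule bounded_linear.has_derivative[OF bounded_linear_vec_nth transition_has_derivative[OF d that]])
    from frechet_derivative_at[OF this, symmetric] show ?thesis
      by (simp add: F_def matrix_vector_mult_basis column_def)
  qed
  show "real_analytic_on (\<lambda>x. coordinate_field v d (chart_inv d x) $ i) (chart_map d ` (chart_dom d \<inter> chart_dom c))"
    unfolding real_analytic_on_pointwise[of _ "chart_map d ` _"]
  proof
    fix y assume y: "y \<in> chart_map d ` (chart_dom d \<inter> chart_dom c)"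
    then obtain q where q: "q \<in> chart_dom d \<inter> chart_dom c" "y = chart_map d q" by blast
    have t: "transition d c y = chart_map c q"
      using q by (simp add: transition_def d.chart_inv_chart_map)
    have an: "real_analytic_on (F j) {transition d c y}" for j
      unfolding F_def
    proof (rule real_analytic_partial_derivative)
      show "real_analytic_on (\<lambda>z. transition c d z $ i) {transition d c y}"
        unfolding t by (rule analytic_transition[OF d]) (use q in blast)
    qed
    have "real_analytic_on (\<lambda>x. transition d c x $ j) {y}" for j
      using y by (rule d.analytic_transition[OF chart])
    then have "real_analytic_on (\<lambda>x. \<Sum>j\<in>UNIV. F j (transition d c x) * v $ j) {y}"
      by (intro real_analytic_sum real_analytic_cmult real_analytic_compose[where g = "transition d c", OF an])
        auto
    then show "real_analytic_on (\<lambda>x. coordinate_field v d (chart_inv d x) $ i) {y}"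
      using U
    proof (rule real_analytic_on_cong)
      show "y \<in> U" using y by (simp add: U_def)
      fix x assume "x \<in> U"
      then obtain q where q: "q \<in> chart_dom d \<inter> chart_dom c" "x = chart_map d q" by (auto simp: U_def)
      then show "(\<Sum>j\<in>UNIV. F j (transition d c x) * v $ j) = coordinate_field v d (chart_inv d x) $ i"
        using F[of q] by (simp add: coordinate_field_def transition_def d.chart_inv_chart_map
            matrix_vector_mult_def)
    qed
  qed
qed

lemma bracket_form_vanishesD:
  assumes "bracket_form_vanishes \<A> A B" and p: "p \<in> chart_dom c"
    and "((\<lambda>x. A c (chart_inv c x)) has_derivative D) (at (chart_map c p))"
    and "((\<lambda>x. B c (chart_inv c x)) has_derivative E) (at (chart_map c p))"
  shows "E (A c p *v v) *v v - D (B c p *v v) *v v + B c p *v (D v *v v) - A c p *v (E v *v v) = 0"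
proof -
  have "bracket_form A B (coordinate_field v) c p = 0"
    using assms(1) open_chart_dom analytic_coordinate_field[of v] chart p
    unfolding bracket_form_vanishes_def by blast
  then show ?thesis
    using bracket_form_constant[where A = A and B = B and \<xi> = "coordinate_field v", OF p assms(3,4)
        coordinate_field_derivative[OF p] coordinate_field_self[OF p]]
    by simp
qed

end

lemma tensor_power_eq: "tensor_power L k c p = matrix_power (L c p) k"
  by (induction k) simp_all

context analytic_chart
begin

lemma torsion_at_imp_nijenhuis_torsion:
  assumes "analytic_vector_field \<A> W \<xi>" "analytic_vector_field \<A> W \<eta>" and p: "p \<in> chart_dom c \<inter> W"
    and D: "((\<lambda>x. L c (chart_inv c x)) has_derivative D) (at (chart_map c p))"
    and zero: "\<And>u v. torsion_at (L c p) D u v = 0"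
  shows "nijenhuis_torsion L \<xi> \<eta> c p = 0"
proof -
  obtain X where X: "((\<lambda>x. \<xi> c (chart_inv c x)) has_derivative X) (at (chart_map c p))"
    using analytic_vector_field_derivative[OF assms(1) p] by blast
  obtain Y where Y: "((\<lambda>x. \<eta> c (chart_inv c x)) has_derivative Y) (at (chart_map c p))"
    using analytic_vector_field_derivative[OF assms(2) p] by blast
  have "p \<in> chart_dom c" using p by blast
  from nijenhuis_torsion_eq[where L = L and \<xi> = \<xi> and \<eta> = \<eta>, OF this D X Y] show ?thesis
    by (simp only: zero)
qed

section \<open>Evaluation of the two bracket conditions\<close>

text \<open>The derivative of the square of L is A D h + D h A. Inserted into the form for L and its
  square, the two terms with A^2 applied to D(v) v cancel and the four terms of the torsion on (v, A
  v) are left.\<close>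

lemma tensor_power_vanishing:
  assumes p: "p \<in> chart_dom c"
    and D: "((\<lambda>x. L c (chart_inv c x)) has_derivative D) (at (chart_map c p))"
    and van: "bracket_form_vanishes \<A> (tensor_power L 1) (tensor_power L 2)"
  shows "torsion_at (L c p) D v (L c p *v v) = 0"
proof -
  have T1: "tensor_power L 1 = L" by (simp add: fun_eq_iff)
  have T2: "tensor_power L 2 c = (\<lambda>q. L c q ** L c q)" by (simp add: fun_eq_iff numeral_2_eq_2)
  have "((\<lambda>x. L c (chart_inv c x) ** L c (chart_inv c x)) has_derivative
      (\<lambda>h. L c p ** D h + D h ** L c p)) (at (chart_map c p))"
    using bounded_bilinear.FDERIV[OF bounded_bilinear_matrix_matrix_mult D D]
    by (simp add: chart_inv_chart_map[OF p])
  then have "((\<lambda>x. tensor_power L 2 c (chart_inv c x)) has_derivative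
      (\<lambda>h. L c p ** D h + D h ** L c p)) (at (chart_map c p))"
    by (simp only: T2)
  from bracket_form_vanishesD[where A = L and B = "tensor_power L 2", OF van[unfolded T1] p D this, of v]
  show ?thesis
    unfolding T2
    by (simp add: torsion_at_def matrix_vector_mul_assoc[symmetric] matrix_vector_mult_add_rdistrib
        matrix_vector_right_distrib algebra_simps)
qed

text \<open>Compared with the first case, the derivatives a of \<open>f 1\<close> and b of
  \<open>f 2\<close> enter. They combine to b + f 1 a - a(A h), and the trace formulas turn this
  into the \<open>\<theta>\<close> of \<open>torsion_at_zero\<close>.\<close>

lemma char_operator_vanishing:
  assumes n: "CARD('n) \<ge> 2" and p: "p \<in> chart_dom c"
    and D: "((\<lambda>x. L c (chart_inv c x)) has_derivative D) (at (chart_map c p))"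
    and f: "has_char_poly \<A> L f"
    and van: "bracket_form_vanishes \<A> (char_operator L f 1) (char_operator L f 2)"
    and \<theta>: "\<And>u. \<theta> u = trace (L c p ** D u) - trace (D (L c p *v u))"
  shows "torsion_at (L c p) D v (L c p *v v)
     = \<theta> (L c p *v v) *\<^sub>R v - \<theta> v *\<^sub>R (L c p *v v)"
proof -
  define M where "M x = L c (chart_inv c x)" for x
  define x0 where "x0 = chart_map c p"
  define A where "A = L c p"
  have M0: "M x0 = A" by (simp add: M_def A_def x0_def chart_inv_chart_map[OF p])
  have M: "(M has_derivative D) (at x0)" using D by (simp add: M_def[abs_def] x0_def)
  have x0: "x0 \<in> chart_map c ` chart_dom c" using p by (simp add: x0_def)
  define a where "a h = trace (D h)" for h
  define b where "b h = trace (A ** D h) - trace A * trace (D h)" for h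
  \<comment> \<open>These formulas hold on the whole chart domain; they make \<open>f 1\<close> and
    \<open>f 2\<close> differentiable and supply their derivatives.\<close>
  have f1: "f 1 q = trace (L c q)" and f2: "f 2 q = (trace (L c q ** L c q) - trace (L c q) ^ 2) / 2"
    if "q \<in> chart_dom c" for q
  proof -
    have "\<And>t. det (t *\<^sub>R mat 1 - L c q) = t ^ CARD('n) - (\<Sum>k=1..CARD('n). f k q * t ^ (CARD('n) - k))"
      using f chart that unfolding has_char_poly_def by blast
    from char_poly_coeffs[where f = "\<lambda>k. f k q", OF n this]
    show "f 1 q = trace (L c q)" "f 2 q = (trace (L c q ** L c q) - trace (L c q) ^ 2) / 2"
      by simp_all
  qed
  have "((\<lambda>x. trace (M x)) has_derivative a) (at x0)"
    unfolding a_def[abs_def] by (rule bounded_linear.has_derivative[OF bounded_linear_trace M])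
  then have F1: "((\<lambda>x. f 1 (chart_inv c x)) has_derivative a) (at x0)"
    using chart_image x0
    by (rule has_derivative_transform_within_open) (auto simp: M_def f1[unfolded One_nat_def] chart_inv_chart_map)
  have MM: "((\<lambda>x. M x ** M x) has_derivative (\<lambda>h. A ** D h + D h ** A)) (at x0)"
    using bounded_bilinear.FDERIV[OF bounded_bilinear_matrix_matrix_mult M M] by (simp add: M0)
  have tMM: "((\<lambda>x. trace (M x ** M x)) has_derivative (\<lambda>h. trace (A ** D h + D h ** A))) (at x0)"
    by (rule bounded_linear.has_derivative[OF bounded_linear_trace MM])
  have tM: "((\<lambda>x. trace (M x)) has_derivative (\<lambda>h. trace (D h))) (at x0)"
    by (rule bounded_linear.has_derivative[OF bounded_linear_trace M])
  have sq: "((\<lambda>x. trace (M x) ^ 2) has_derivative (\<lambda>h. 2 * trace A * trace (D h))) (at x0)"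
    using has_derivative_power[OF tM, of 2] by (simp add: M0 mult_ac)
  have "(\<lambda>h. 1 / 2 * (trace (A ** D h + D h ** A) - 2 * trace A * trace (D h))) = b"
  proof
    show "1 / 2 * (trace (A ** D h + D h ** A) - 2 * trace A * trace (D h)) = b h" for h
      unfolding b_def trace_add trace_mul_sym[of "D h" A] by (simp add: field_simps)
  qed
  with has_derivative_mult_right[OF has_derivative_diff[OF tMM sq], of "1 / 2"]
  have "((\<lambda>x. 1 / 2 * (trace (M x ** M x) - trace (M x) ^ 2)) has_derivative b) (at x0)"
    by (simp only:)
  then have F2: "((\<lambda>x. f 2 (chart_inv c x)) has_derivative b) (at x0)"
    using chart_image x0
    by (rule has_derivative_transform_within_open) (auto simp: M_def f2 chart_inv_chart_map)
  define M1 where "M1 = A - f 1 p *\<^sub>R mat 1"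
  define D1 where "D1 h = D h - a h *\<^sub>R mat 1" for h
  define D2 where "D2 h = A ** D1 h + D h ** M1 - b h *\<^sub>R mat 1" for h
  have C1: "char_operator L f 1 c (chart_inv c x) = M x - f 1 (chart_inv c x) *\<^sub>R mat 1" for x
    by (simp add: M_def)
  have C2: "char_operator L f 2 c (chart_inv c x) =
      M x ** (M x - f 1 (chart_inv c x) *\<^sub>R mat 1) - f 2 (chart_inv c x) *\<^sub>R mat 1" for x
    by (simp add: M_def numeral_2_eq_2)
  have E1: "((\<lambda>x. M x - f 1 (chart_inv c x) *\<^sub>R mat 1) has_derivative D1) (at x0)"
    unfolding D1_def[abs_def] by (intro has_derivative_diff M has_derivative_scaleR_left F1)
  have "((\<lambda>x. M x ** (M x - f 1 (chart_inv c x) *\<^sub>R mat 1)) has_derivative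
      (\<lambda>h. A ** D1 h + D h ** M1)) (at x0)"
    using bounded_bilinear.FDERIV[OF bounded_bilinear_matrix_matrix_mult M E1]
    by (simp add: M0 M1_def) (simp add: x0_def chart_inv_chart_map[OF p])
  then have E2: "((\<lambda>x. M x ** (M x - f 1 (chart_inv c x) *\<^sub>R mat 1) - f 2 (chart_inv c x) *\<^sub>R mat 1)
      has_derivative D2) (at x0)"
    unfolding D2_def[abs_def] by (intro has_derivative_diff has_derivative_scaleR_left F2)
  have d: "D2 (char_operator L f 1 c p *v v) *v v - D1 (char_operator L f 2 c p *v v) *v v
      + char_operator L f 2 c p *v (D1 v *v v) - char_operator L f 1 c p *v (D2 v *v v) = 0"
    by (rule bracket_form_vanishesD[OF van p])
       (use E1 E2 in \<open>simp_all only: C1 C2 x0_def\<close>)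
  have c1: "char_operator L f 1 c p = M1" by (simp add: M1_def A_def)
  have c2: "char_operator L f 2 c p = A ** M1 - f 2 p *\<^sub>R mat 1"
    by (simp add: M1_def A_def numeral_2_eq_2)
  have lin: "linear D" "linear a" "linear b"
    using M F1 F2 has_derivative_linear by blast+
  note lins = linear_add[OF lin(1)] linear_diff[OF lin(1)] linear_scale[OF lin(1)]
    linear_add[OF lin(2)] linear_diff[OF lin(2)] linear_scale[OF lin(2)]
    linear_add[OF lin(3)] linear_diff[OF lin(3)] linear_scale[OF lin(3)]
  have th: "\<theta> u = b u + f 1 p * a u - a (A *v u)" for u
    by (simp add: \<theta> b_def a_def A_def f1[OF p, unfolded One_nat_def])
  \<comment> \<open>In the expansion the undifferentiated \<open>f 2 p\<close> cancels, and so do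
    the products of \<open>f 1 p\<close> with b; the remaining scalar terms assemble to
    \<open>\<theta>\<close>.\<close>
  show ?thesis
    unfolding vec_eq_iff
  proof
    fix i
    show "torsion_at (L c p) D v (L c p *v v) $ i
       = (\<theta> (L c p *v v) *\<^sub>R v - \<theta> v *\<^sub>R (L c p *v v)) $ i"
      using arg_cong[OF d, of "\<lambda>w. w $ i"]
      unfolding c1 c2 D1_def D2_def M1_def torsion_at_def th A_def[symmetric]
      by (simp add: lins matrix_vector_mul_assoc[symmetric] matrix_vector_mult_add_rdistrib
          matrix_vector_mult_diff_rdistrib matrix_vector_mult_diff_distrib
          matrix_vector_right_distrib scaleR_matrix_vector_assoc[symmetric] matrix_vector_mult_scaleR
          algebra_simps)
  qed
qed

lemma nijenhuis_torsion_zero: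
  assumes n: "CARD('n) > 2" and L: "analytic_tensor_field \<A> L" and reg: "gl_regular \<A> L"
    and fields: "analytic_vector_field \<A> W \<xi>" "analytic_vector_field \<A> W \<eta>"
    and p: "p \<in> chart_dom c \<inter> W"
    and van: "bracket_form_vanishes \<A> (tensor_power L 1) (tensor_power L 2) \<or>
      has_char_poly \<A> L f \<and> bracket_form_vanishes \<A> (char_operator L f 1) (char_operator L f 2)"
  shows "nijenhuis_torsion L \<xi> \<eta> c p = 0"
proof -
  have p': "p \<in> chart_dom c" using p by blast
  obtain D where D: "((\<lambda>x. L c (chart_inv c x)) has_derivative D) (at (chart_map c p))" "linear D"
    using analytic_tensor_field_derivative[OF L p'] by blast
  have "(\<Sum>k<CARD('n). a k *\<^sub>R matrix_power (L c p) k) = 0 \<Longrightarrow> \<forall>k<CARD('n). a k = 0" for a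
    using reg chart p' unfolding gl_regular_def tensor_power_eq by blast
  then obtain z where z: "span ((\<lambda>k. matrix_power (L c p) k *v z) ` {..<CARD('n)}) = UNIV"
    by (rule ex_cyclic_vector)
  show ?thesis
  proof (rule torsion_at_imp_nijenhuis_torsion[where L = L, OF fields p D(1)])
    fix u v
    from van show "torsion_at (L c p) D u v = 0"
    proof (elim disjE conjE)
      assume "bracket_form_vanishes \<A> (tensor_power L 1) (tensor_power L 2)"
      from tensor_power_vanishing[OF p' D(1) this] show ?thesis
        by (rule alternating_form_zero[OF z bilinear_torsion_at[OF D(2)] torsion_at_swap])
    next
      assume "has_char_poly \<A> L f" "bracket_form_vanishes \<A> (char_operator L f 1) (char_operator L f 2)"
      from char_operator_vanishing[OF _ p' D(1) this refl] n show ?thesis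
        by (intro torsion_at_zero[OF n D(2) z refl]) simp
    qed
  qed
qed

end

theorem proposition3p3:
  fixes \<A> :: "('m :: {t2_space, second_countable_topology}, 'n :: finite) chart set"
    and L :: "('m, 'n) tfield"
    and f :: "nat \<Rightarrow> 'm \<Rightarrow> real"
  assumes "analytic_atlas \<A>"
    and "CARD('n) > 2"
    and "analytic_tensor_field \<A> L"
    and "gl_regular \<A> L"
    and "has_char_poly \<A> L f"
  shows "((\<forall>i j. 1 \<le> i \<and> i < j \<and> j \<le> CARD('n) - 1 \<longrightarrow>
            bracket_form_vanishes \<A> (tensor_power L i) (tensor_power L j))
          \<longrightarrow> nijenhuis_operator \<A> L)
       \<and> ((\<forall>i j. 1 \<le> i \<and> i < j \<and> j \<le> CARD('n) - 1 \<longrightarrow>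
            bracket_form_vanishes \<A> (char_operator L f i) (char_operator L f j))
          \<longrightarrow> nijenhuis_operator \<A> L)"
proof -
  have *: "nijenhuis_operator \<A> L"
    if "bracket_form_vanishes \<A> (tensor_power L 1) (tensor_power L 2) \<or>
      has_char_poly \<A> L f \<and> bracket_form_vanishes \<A> (char_operator L f 1) (char_operator L f 2)"
    unfolding nijenhuis_operator_def
  proof (intro allI impI ballI)
    fix W \<xi> \<eta> c p
    assume fields: "analytic_vector_field \<A> W \<xi>" "analytic_vector_field \<A> W \<eta>"
      and c: "c \<in> \<A>" and p: "p \<in> chart_dom c \<inter> W"
    interpret analytic_chart \<A> c by unfold_locales (rule assms(1) c)+
    show "nijenhuis_torsion L \<xi> \<eta> c p = 0"
      by (rule nijenhuis_torsion_zero[OF assms(2-4) fields p that])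
  qed
  \<comment> \<open>For n > 2 the pair (1, 2) is within the range of the hypotheses.\<close>
  have 12: "1 \<le> (1::nat) \<and> (1::nat) < 2 \<and> 2 \<le> CARD('n) - 1" using assms(2) by simp
  show ?thesis
  proof (intro conjI impI)
    assume "\<forall>i j. 1 \<le> i \<and> i < j \<and> j \<le> CARD('n) - 1 \<longrightarrow>
      bracket_form_vanishes \<A> (tensor_power L i) (tensor_power L j)"
    from this[rule_format, OF 12] show "nijenhuis_operator \<A> L" by (intro * disjI1)
  next
    assume "\<forall>i j. 1 \<le> i \<and> i < j \<and> j \<le> CARD('n) - 1 \<longrightarrow>
      bracket_form_vanishes \<A> (char_operator L f i) (char_operator L f j)"
    from this[rule_format, OF 12] assms(5) show "nijenhuis_operator \<A> L" by (intro * disjI2 conjI)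
  qed
qed

end
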